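(* Let $\mathsf{A}=\{f_1,\dots,f_m\}\subset C^r(\mathbb{R}^n;\mathbb{R})$ be linearly independent and suppose that $r>\mathcal{N}_{\mathsf{A}}\cdot(n+1)-m$. Then $$\mathcal{N}_{\mathsf{A}}\le\mathcal{C}_{\mathsf{A}} .$$ Further, the set of moment sequences $s$ of $\mathsf{A}$ which can be represented by less than $\mathcal{N}_{\mathsf{A}}$ atoms has $m$-dimensional Lebesgue measure zero in $\mathbb{R}^m$.
   Context: Here $r\in\mathbb{N}$ and $\mathcal{X}=\mathbb{R}^n$. A vector $s=(s_j)_{j=1}^m\in\mathbb{R}^m$ is a moment sequence of $\mathsf{A}$ if there is a positive Radon measure $\mu$ on $\mathbb{R}^n$ such that all $f_j$ are $\mu$-integrable and $s_j=\int f_j\,d\mu$ for all $j$; $\mu$ is then called a representing measure of $s$. A $k$-atomic measure is $\sum_{i=1}^k c_i\delta_{x_i}$ with pairwise different points $x_i$ and all $c_i>0$ (the zero measure is $0$-atomic). The Carathéodory number $\mathcal{C}_{\mathsf{A}}$ is the smallest number such that every moment sequence of $\mathsf{A}$ has a $k$-atomic representing measure with $k\le\mathcal{C}_{\mathsf{A}}$. Let $s_{\mathsf{A}}(x)=(f_1(x),\dots,f_m(x))^T$ and $S_{k,\mathsf{A}}(C,X)=\sum_{i=1}^k c_i s_{\mathsf{A}}(x_i)$ for $C=(c_1,\dots,c_k)$, $c_i\ge0$, and $X=(x_1,\dots,x_k)$, $x_i\in\mathbb{R}^n$. $DS_{k,\mathsf{A}}$ is the total derivative of $S_{k,\mathsf{A}}$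 with respect to all $c_i$ and all coordinates of all $x_i$, that is, the matrix with columns $s_{\mathsf{A}}(x_i)$ and $c_i\partial_l s_{\mathsf{A}}(x_i)$, $i=1,\dots,k$, $l=1,\dots,n$. $\mathcal{N}_{\mathsf{A}}$ is the smallest $k\in\mathbb{N}$ such that $DS_{k,\mathsf{A}}(C,X)$ has rank $m=|\mathsf{A}|$ for some $(C,X)$. *)

theory Defs
  imports "HOL-Analysis.Analysis"
begin

text \<open>
  A family \<open>f :: 'm \<Rightarrow> real^'n \<Rightarrow> real\<close> stands for the set
  \<open>{f\<^sub>1, \<dots>, f\<^sub>m}\<close> of functions on \<open>n\<close>-dimensional space, with
  \<open>m = CARD('m)\<close> and \<open>n = CARD('n)\<close>.
\<close>

text \<open>
  The partial derivative is taken as the total derivative applied to a unit vector; it is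
  used only at points of differentiability. Requiring total differentiability in \<open>C_diff\<close> costs
  nothing, since it follows from the continuity of the partial derivatives.
\<close>

definition partial_deriv ::
    "'n \<Rightarrow> (real^'n::finite \<Rightarrow> 'b::real_normed_vector) \<Rightarrow> real^'n \<Rightarrow> 'b" where
  "partial_deriv l g x = frechet_derivative g (at x) (axis l 1)"

fun C_diff :: "nat \<Rightarrow> (real^'n::finite \<Rightarrow> real) \<Rightarrow> bool" where
  "C_diff 0 g \<longleftrightarrow> continuous_on UNIV g"
| "C_diff (Suc r) g \<longleftrightarrow>
     (\<forall>x. g differentiable (at x)) \<and> (\<forall>l. C_diff r (partial_deriv l g))"

text \<open>
  Linear independence of the family; in particular its members are pairwise different,
  so that the set they form has exactly \<open>m\<close> elements.
\<close>

definition lin_indep :: "('m::finite \<Rightarrow> 'x \<Rightarrow> real) \<Rightarrow> bool" where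
  "lin_indep f \<longleftrightarrow> (\<forall>a. (\<forall>x. (\<Sum>j\<in>UNIV. a j * f j x) = 0) \<longrightarrow> (\<forall>j. a j = 0))"

definition radon_measure :: "(real^'n::finite) measure \<Rightarrow> bool" where
  "radon_measure \<mu> \<longleftrightarrow>
     sets \<mu> = sets borel \<and>
     (\<forall>K. compact K \<longrightarrow> emeasure \<mu> K < \<infinity>) \<and>
     (\<forall>B\<in>sets borel. emeasure \<mu> B = (SUP K\<in>{K. compact K \<and> K \<subseteq> B}. emeasure \<mu> K))"

definition represents ::
    "(real^'n::finite) measure \<Rightarrow> ('m::finite \<Rightarrow> real^'n \<Rightarrow> real) \<Rightarrow> real^'m \<Rightarrow> bool" where
  "represents \<mu> f s \<longleftrightarrow>
     radon_measure \<mu> \<and> (\<forall>j. integrable \<mu> (f j) \<and> s $ j = (\<integral>x. f j x \<partial>\<mu>))"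

definition moment_sequences ::
    "('m::finite \<Rightarrow> real^'n::finite \<Rightarrow> real) \<Rightarrow> (real^'m) set" where
  "moment_sequences f = {s. \<exists>\<mu>. represents \<mu> f s}"

text \<open>
  \<open>\<mu> = (\<Sum>i<k. c\<^sub>i \<delta>\<^bsub>x\<^sub>i\<^esub>)\<close>, evaluated on Borel sets, where the Dirac measure at \<open>x\<close> takes
  the value \<open>indicator B x\<close> on \<open>B\<close>. Indices run over \<open>{..<k}\<close> throughout.
\<close>

definition atomic_measure :: "nat \<Rightarrow> (real^'n::finite) measure \<Rightarrow> bool" where
  "atomic_measure k \<mu> \<longleftrightarrow>
     sets \<mu> = sets borel \<and>
     (\<exists>c x. (\<forall>i<k. 0 < c i) \<and> inj_on x {..<k} \<and>
        (\<forall>B\<in>sets borel. emeasure \<mu> B = (\<Sum>i<k. ennreal (c i) * indicator B (x i))))"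

definition atomic_representable ::
    "nat \<Rightarrow> ('m::finite \<Rightarrow> real^'n::finite \<Rightarrow> real) \<Rightarrow> real^'m \<Rightarrow> bool" where
  "atomic_representable k f s \<longleftrightarrow> (\<exists>\<mu>. atomic_measure k \<mu> \<and> represents \<mu> f s)"

text \<open>
  The minimum exists: by Richter's theorem every moment sequence has a representing
  measure with at most \<open>m\<close> atoms.
\<close>

definition caratheodory_number :: "('m::finite \<Rightarrow> real^'n::finite \<Rightarrow> real) \<Rightarrow> nat" where
  "caratheodory_number f =
     (LEAST K. \<forall>s\<in>moment_sequences f. \<exists>k\<le>K. atomic_representable k f s)"

definition s_vec :: "('m::finite \<Rightarrow> real^'n::finite \<Rightarrow> real) \<Rightarrow> real^'n \<Rightarrow> real^'m" where
  "s_vec f x = (\<chi> j. f j x)"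

definition S_map ::
    "nat \<Rightarrow> ('m::finite \<Rightarrow> real^'n::finite \<Rightarrow> real) \<Rightarrow> (nat \<Rightarrow> real) \<Rightarrow> (nat \<Rightarrow> real^'n) \<Rightarrow> real^'m" where
  "S_map k f C X = (\<Sum>i<k. C i *\<^sub>R s_vec f (X i))"

text \<open>
  The number of columns of the derivative of \<open>S_map k f\<close> depends on \<open>k\<close>, so the matrix is given by
  the set of its columns and its rank by the dimension of their span. That these columns are the
  partial derivatives of \<open>S_map k f\<close> is shown in the two lemmas below.
\<close>

definition DS_columns ::
    "nat \<Rightarrow> ('m::finite \<Rightarrow> real^'n::finite \<Rightarrow> real) \<Rightarrow> (nat \<Rightarrow> real) \<Rightarrow> (nat \<Rightarrow> real^'n) \<Rightarrow> (real^'m) set" where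
  "DS_columns k f C X =
     {s_vec f (X i) |i. i < k} \<union> {C i *\<^sub>R partial_deriv l (s_vec f) (X i) |i l. i < k}"

definition DS_rank ::
    "nat \<Rightarrow> ('m::finite \<Rightarrow> real^'n::finite \<Rightarrow> real) \<Rightarrow> (nat \<Rightarrow> real) \<Rightarrow> (nat \<Rightarrow> real^'n) \<Rightarrow> nat" where
  "DS_rank k f C X = dim (span (DS_columns k f C X))"

lemma S_map_deriv_weight:
  assumes "i < k"
  shows "((\<lambda>t. S_map k f (C(i := t)) X) has_vector_derivative s_vec f (X i)) (at (C i))"
proof -
  have "S_map k f (C(i := t)) X = t *\<^sub>R s_vec f (X i) + (\<Sum>j\<in>{..<k}-{i}. C j *\<^sub>R s_vec f (X j))" for t
    unfolding S_map_def using assms by (subst sum.remove[of _ i]) (auto intro!: sum.cong)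
  then show ?thesis
    by (auto intro!: derivative_eq_intros)
qed

lemma S_map_deriv_point:
  assumes "i < k" and "\<And>j. f j differentiable (at (X i))"
  shows "((\<lambda>t. S_map k f C (X(i := X i + t *\<^sub>R axis l 1)))
           has_vector_derivative C i *\<^sub>R partial_deriv l (s_vec f) (X i)) (at 0)"
proof -
  have eq: "S_map k f C (X(i := X i + t *\<^sub>R axis l 1)) =
      C i *\<^sub>R s_vec f (X i + t *\<^sub>R axis l 1) + (\<Sum>j\<in>{..<k}-{i}. C j *\<^sub>R s_vec f (X j))" for t
    unfolding S_map_def using assms by (subst sum.remove[of _ i]) (auto intro!: sum.cong)
  have "s_vec f differentiable (at (X i))"
    unfolding differentiable_componentwise_within[where f = "s_vec f"]
    using assms(2) by (auto simp: s_vec_def Basis_vec_def inner_axis)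
  then have D: "(s_vec f has_derivative frechet_derivative (s_vec f) (at (X i))) (at (X i))"
    by (simp add: frechet_derivative_works)
  have "((\<lambda>t. s_vec f (X i + t *\<^sub>R axis l 1)) has_vector_derivative
          partial_deriv l (s_vec f) (X i)) (at 0)"
  proof -
    have g: "((\<lambda>t::real. X i + t *\<^sub>R axis l 1) has_vector_derivative axis l 1) (at 0)"
      by (auto intro!: derivative_eq_intros)
    have "((s_vec f) has_derivative frechet_derivative (s_vec f) (at (X i)))
        (at (X i + (0::real) *\<^sub>R axis l 1))"
      using D by simp
    from vector_derivative_diff_chain_within[OF g has_derivative_at_withinI[OF this]]
    show ?thesis by (simp add: o_def partial_deriv_def)
  qed
  then show ?thesis
    unfolding eq by (auto intro!: derivative_eq_intros)
qed

text \<open>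
  For linearly independent \<open>f\<close> the minimum exists: there are \<open>m\<close> points at which the vectors
  \<open>s_vec f\<close> span the whole space.
\<close>

definition N_number :: "('m::finite \<Rightarrow> real^'n::finite \<Rightarrow> real) \<Rightarrow> nat" where
  "N_number f =
     (LEAST k. \<exists>C X. (\<forall>i<k. 0 \<le> C i) \<and> DS_rank k f C X = CARD('m))"

end

theory Submission
  imports Defs
begin

text \<open>
  If \<open>k\<close> is less than \<open>N_number f\<close>, then every \<open>(C, X)\<close> with \<open>C \<ge> 0\<close> is a critical point of
  \<open>S_map k f\<close>, so by the Morse--Sard theorem the vectors represented by \<open>k\<close> atoms form a null set.
  Since the number of variables \<open>k(n+1)\<close> may exceed \<open>m\<close>, the sharp form of Sard's theorem for C^r
  functions is needed. It is proved by induction on the number of components: where some derivative is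
  nonzero, one component is straightened into a coordinate and Fubini is applied to the slices; where all
  derivatives vanish, the set is decomposed into countably many pieces, parametrized by bounded sets, on which
  functions vanishing there vanish to high order, and small cubes are counted.

  By Richter's theorem the moment sequences form the convex cone generated by the values of \<open>s_vec f\<close>. Its
  interior is nonempty by linear independence, so it is not a null set, and fewer than \<open>N_number f\<close>
  atoms cannot suffice.
\<close>

section \<open>Functions of class C^r on open sets\<close>

text \<open>The hypothesis on r enters as d + 1 \<le> r + p for d variables and p components.
  Slicing preserves this: fixing one component removes one variable and one component. Where all
  first derivatives vanish it yields d \<le> r p, because (r - 1)(p - 1) \<ge> 0, and this is what
  the counting needs: about \<delta>^(-d) cubes of size \<delta>, each with an image of volume
  o(\<delta>^(r p)). The obstacle is that vanishing first derivatives alone do not make a function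
  vary by only o(\<delta>^r); this becomes true after the set is cut into pieces and reparametrized,
  possibly over fewer variables. As the number of variables changes during the proof while types are
  fixed, domains are subspaces of one Euclidean space, and only derivatives along the subspace enter
  the rank condition. Weights are taken with C \<ge> 0 rather than C > 0: the closed condition gives
  compact parameter sets, and at C i = 0 the derivative of the map loses the same columns as the
  matrix.\<close>

fun Cr :: "nat \<Rightarrow> 'a::euclidean_space set \<Rightarrow> ('a \<Rightarrow> 'b::real_normed_vector) \<Rightarrow> bool" where
  "Cr 0 S f \<longleftrightarrow> continuous_on S f"
| "Cr (Suc r) S f \<longleftrightarrow>
     (\<forall>x\<in>S. f differentiable (at x)) \<and> (\<forall>v\<in>Basis. Cr r S (\<lambda>x. frechet_derivative f (at x) v))"

lemma Cr_subset: "Cr r S f \<Longrightarrow> T \<subseteq> S \<Longrightarrow> Cr r T f"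
  by (induction r arbitrary: f) (auto intro: continuous_on_subset)

lemma Cr_Suc_D: "Cr (Suc r) S f \<Longrightarrow> Cr r S f"
proof (induction r arbitrary: f)
  case 0
  then show ?case
    by (simp add: continuous_at_imp_continuous_on differentiable_imp_continuous_within)
qed auto

lemma Cr_le: "Cr r S f \<Longrightarrow> q \<le> r \<Longrightarrow> Cr q S f"
  by (induction r) (auto simp: le_Suc_eq intro: Cr_Suc_D simp del: Cr.simps)

lemma Cr_continuous_on: "Cr r S f \<Longrightarrow> continuous_on S f"
  using Cr_le[of r S f 0] by simp

lemma Cr_has_derivative:
  assumes "Cr (Suc r) S f" "x \<in> S"
  shows "(f has_derivative frechet_derivative f (at x)) (at x)"
  using assms frechet_derivative_works by auto

lemma frechet_derivative_cong_open:
  assumes "open S" "x \<in> S" "\<And>y. y \<in> S \<Longrightarrow> f y = g y"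
  shows "frechet_derivative f (at x) = frechet_derivative g (at x)"
proof -
  have "(f has_derivative D) (at x) \<longleftrightarrow> (g has_derivative D) (at x)" for D
    using assms has_derivative_transform_within_open[of f D x UNIV S g]
      has_derivative_transform_within_open[of g D x UNIV S f] by auto
  then show ?thesis
    by (simp add: frechet_derivative_def)
qed

lemma Cr_cong:
  assumes "open S" "\<And>y. y \<in> S \<Longrightarrow> f y = g y" "Cr r S f"
  shows "Cr r S g"
  using assms(2,3)
proof (induction r arbitrary: f g)
  case 0
  then show ?case using continuous_on_cong[of S S f g] by auto
next
  case (Suc r)
  have "g differentiable (at x)" if "x \<in> S" for x
    using has_derivative_transform_within_open[OF Cr_has_derivative[OF Suc.prems(2) that] assms(1) that Suc.prems(1)]
    by (auto simp: differentiable_def)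
  moreover have "Cr r S (\<lambda>x. frechet_derivative g (at x) v)" if "v \<in> Basis" for v
  proof (rule Suc.IH)
    show "frechet_derivative f (at y) v = frechet_derivative g (at y) v" if "y \<in> S" for y
      using frechet_derivative_cong_open[where f=f and g=g, OF assms(1) that Suc.prems(1)] by simp
  qed (use Suc.prems(2) that in simp)
  ultimately show ?case by auto
qed

text \<open>\<open>Cr\<close> recurses through the directional derivatives along
  \<open>Basis\<close>, because the total derivative would change the codomain type at every step.
  The rule accepts any explicit derivative, so the closure proofs only supply the formula of a
  calculus rule.\<close>

lemma Cr_SucI:
  assumes "open S" "\<And>x. x \<in> S \<Longrightarrow> (f has_derivative f' x) (at x)"
    and "\<And>v. v \<in> Basis \<Longrightarrow> Cr r S (\<lambda>x. f' x v)"
  shows "Cr (Suc r) S f"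
proof -
  have "frechet_derivative f (at x) = f' x" if "x \<in> S" for x
    using frechet_derivative_at[OF assms(2)[OF that]] by simp
  then have "Cr r S (\<lambda>x. frechet_derivative f (at x) v)" if "v \<in> Basis" for v
    using that by (intro Cr_cong[OF assms(1) _ assms(3)[of v]]) auto
  then show ?thesis
    using assms(2) by (auto simp: differentiable_def)
qed

lemma Cr_const [simp]: "open S \<Longrightarrow> Cr r S (\<lambda>x. c)"
  by (induction r arbitrary: c) (auto simp del: Cr.simps(2) intro!: Cr_SucI[where f'="\<lambda>x h. 0"])

lemma Cr_bounded_linear:
  assumes "open S" "bounded_linear L"
  shows "Cr r S L"
proof (cases r)
  case 0
  then show ?thesis using assms(2) linear_continuous_on by auto
next
  case (Suc q)
  then show ?thesis
    using assms
    by (auto simp del: Cr.simps(2) intro!: Cr_SucI[where f'="\<lambda>x. L"] bounded_linear_imp_has_derivative)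
qed

lemma Cr_add:
  assumes "open S" "Cr r S f" "Cr r S g"
  shows "Cr r S (\<lambda>x. f x + g x)"
  using assms(2,3)
proof (induction r arbitrary: f g)
  case 0
  then show ?case by (auto intro: continuous_intros)
next
  case (Suc r)
  show ?case
  proof (rule Cr_SucI[OF assms(1)])
    show "((\<lambda>x. f x + g x) has_derivative (\<lambda>h. frechet_derivative f (at x) h + frechet_derivative g (at x) h)) (at x)"
      if "x \<in> S" for x
      using that Suc.prems by (intro has_derivative_add Cr_has_derivative)
    show "Cr r S (\<lambda>x. frechet_derivative f (at x) v + frechet_derivative g (at x) v)" if "v \<in> Basis" for v
      using Suc.prems that by (intro Suc.IH) auto
  qed
qed

lemma Cr_linear_compose:
  assumes "open S" "bounded_linear L" "Cr r S f"
  shows "Cr r S (\<lambda>x. L (f x))"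
  using assms(3)
proof (induction r arbitrary: f)
  case 0
  then show ?case
    using assms(2) by (auto intro: bounded_linear.continuous_on)
next
  case (Suc r)
  show ?case
  proof (rule Cr_SucI[OF assms(1)])
    show "((\<lambda>x. L (f x)) has_derivative (\<lambda>h. L (frechet_derivative f (at x) h))) (at x)"
      if "x \<in> S" for x
      using that Suc.prems by (intro bounded_linear.has_derivative[OF assms(2)] Cr_has_derivative)
    show "Cr r S (\<lambda>x. L (frechet_derivative f (at x) v))" if "v \<in> Basis" for v
      using Suc.prems that by (intro Suc.IH) auto
  qed
qed

lemma Cr_minus:
  assumes "open S" "Cr r S f" "Cr r S g"
  shows "Cr r S (\<lambda>x. f x - g x)"
  using Cr_add[OF assms(1,2) Cr_linear_compose[OF assms(1) bounded_linear_minus[OF bounded_linear_ident] assms(3)]]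
  by simp

lemma Cr_sum:
  assumes "open S" "\<And>i. i \<in> I \<Longrightarrow> Cr r S (f i)"
  shows "Cr r S (\<lambda>x. \<Sum>i\<in>I. f i x)"
proof (cases "finite I")
  case True
  then show ?thesis using assms(2)
    by (induction I) (auto simp: assms(1) intro: Cr_add)
qed (simp add: assms(1))

lemma Cr_scaleR:
  fixes f :: "'a::euclidean_space \<Rightarrow> real"
  assumes "open S" "Cr r S f" "Cr r S g"
  shows "Cr r S (\<lambda>x. f x *\<^sub>R g x)"
  using assms(2,3)
proof (induction r arbitrary: f g)
  case 0
  then show ?case by (auto intro: continuous_intros)
next
  case (Suc r)
  show ?case
  proof (rule Cr_SucI[OF assms(1)])
    show "((\<lambda>x. f x *\<^sub>R g x) has_derivative
        (\<lambda>h. f x *\<^sub>R frechet_derivative g (at x) h + frechet_derivative f (at x) h *\<^sub>R g x)) (at x)"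
      if "x \<in> S" for x
      using that Suc.prems by (intro has_derivative_scaleR Cr_has_derivative)
    show "Cr r S (\<lambda>x. f x *\<^sub>R frechet_derivative g (at x) v + frechet_derivative f (at x) v *\<^sub>R g x)"
      if "v \<in> Basis" for v
      using Suc.prems that Cr_Suc_D[OF Suc.prems(1)] Cr_Suc_D[OF Suc.prems(2)]
      by (intro Cr_add assms(1) Suc.IH) auto
  qed
qed

lemma Cr_mult:
  fixes f g :: "'a::euclidean_space \<Rightarrow> real"
  shows "open S \<Longrightarrow> Cr r S f \<Longrightarrow> Cr r S g \<Longrightarrow> Cr r S (\<lambda>x. f x * g x)"
  using Cr_scaleR[of S r f g] by simp

lemma Cr_inverse:
  fixes f :: "'a::euclidean_space \<Rightarrow> real"
  assumes "open S" "Cr r S f" "\<And>x. x \<in> S \<Longrightarrow> f x \<noteq> 0"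
  shows "Cr r S (\<lambda>x. inverse (f x))"
  using assms(2)
proof (induction r)
  case 0
  then show ?case using assms(3) by (auto intro: continuous_on_inverse)
next
  case (Suc r)
  show ?case
  proof (rule Cr_SucI[OF assms(1)])
    show "((\<lambda>x. inverse (f x)) has_derivative
        (\<lambda>h. - (inverse (f x) * frechet_derivative f (at x) h * inverse (f x)))) (at x)"
      if "x \<in> S" for x
      using that Suc.prems by (intro Deriv.has_derivative_inverse Cr_has_derivative assms(3))
    fix v :: 'a assume v: "v \<in> Basis"
    have inv: "Cr r S (\<lambda>x. inverse (f x))"
      by (rule Suc.IH[OF Cr_Suc_D[OF Suc.prems]])
    have D: "Cr r S (\<lambda>x. frechet_derivative f (at x) v)"
      using Suc.prems v by simp
    show "Cr r S (\<lambda>x. - (inverse (f x) * frechet_derivative f (at x) v * inverse (f x)))"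
      by (rule Cr_linear_compose[OF assms(1) bounded_linear_minus[OF bounded_linear_ident]
            Cr_mult[OF assms(1) Cr_mult[OF assms(1) inv D] inv]])
  qed
qed

lemma linear_Basis_expansion:
  fixes f :: "'a::euclidean_space \<Rightarrow> 'b::real_vector"
  assumes "linear f"
  shows "f h = (\<Sum>b\<in>Basis. (h \<bullet> b) *\<^sub>R f b)"
proof -
  have "f h = f (\<Sum>b\<in>Basis. (h \<bullet> b) *\<^sub>R b)"
    by (simp add: euclidean_representation)
  then show ?thesis
    using assms by (simp add: linear_sum linear_cmul)
qed

lemma linear_frechet_derivative: "f differentiable (at x) \<Longrightarrow> linear (frechet_derivative f (at x))"
  by (simp add: frechet_derivative_works has_derivative_linear)

lemma Cr_frechet_derivative:
  assumes "open S" "Cr (Suc r) S f"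
  shows "Cr r S (\<lambda>x. frechet_derivative f (at x) h)"
proof (rule Cr_cong[OF assms(1)])
  show "(\<Sum>b\<in>Basis. (h \<bullet> b) *\<^sub>R frechet_derivative f (at x) b) = frechet_derivative f (at x) h"
    if "x \<in> S" for x
    using assms(2) that by (intro linear_Basis_expansion[OF linear_frechet_derivative[of f x], symmetric]) simp
  show "Cr r S (\<lambda>x. \<Sum>b\<in>Basis. (h \<bullet> b) *\<^sub>R frechet_derivative f (at x) b)"
    using assms by (intro Cr_sum Cr_scaleR Cr_const) auto
qed

text \<open>In the chain rule the derivative of \<open>f\<close> acts on a vector that varies with
  the point. Expanding over \<open>Basis\<close> turns this into a sum of products, to which the
  induction hypothesis and the product rule apply.\<close>

lemma Cr_compose:
  fixes g :: "'a::euclidean_space \<Rightarrow> 'b::euclidean_space"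
  assumes "open S" "open T" "Cr r T f" "Cr r S g" "g ` S \<subseteq> T"
  shows "Cr r S (\<lambda>x. f (g x))"
  using assms(3,4)
proof (induction r arbitrary: f)
  case 0
  then show ?case using assms(5) continuous_on_compose2[of T f S g] by auto
next
  case (Suc r)
  have g: "Cr r S g" using Suc.prems(2) by (rule Cr_Suc_D)
  have lin: "linear (frechet_derivative f (at (g x)))" if "x \<in> S" for x
  proof -
    have "g x \<in> T" using that assms(5) by blast
    then show ?thesis
      using Suc.prems(1) by (intro linear_frechet_derivative) simp
  qed
  show ?case
  proof (rule Cr_SucI[OF assms(1)])
    show "((\<lambda>x. f (g x)) has_derivative
        (\<lambda>h. frechet_derivative f (at (g x)) (frechet_derivative g (at x) h))) (at x)"
      if "x \<in> S" for x
    proof -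
      have "g x \<in> T" using that assms(5) by blast
      from has_derivative_compose[OF Cr_has_derivative[OF Suc.prems(2) that] Cr_has_derivative[OF Suc.prems(1) this]]
      show ?thesis .
    qed
    fix v :: 'a assume v: "v \<in> Basis"
    show "Cr r S (\<lambda>x. frechet_derivative f (at (g x)) (frechet_derivative g (at x) v))"
    proof (rule Cr_cong[OF assms(1)])
      show "(\<Sum>b\<in>Basis. (frechet_derivative g (at x) v \<bullet> b) *\<^sub>R frechet_derivative f (at (g x)) b) =
        frechet_derivative f (at (g x)) (frechet_derivative g (at x) v)" if "x \<in> S" for x
        by (rule linear_Basis_expansion[OF lin[OF that], symmetric])
      show "Cr r S (\<lambda>x. \<Sum>b\<in>Basis. (frechet_derivative g (at x) v \<bullet> b) *\<^sub>R frechet_derivative f (at (g x)) b)"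
      proof (intro Cr_sum Cr_scaleR assms(1))
        fix b :: 'b assume b: "b \<in> Basis"
        have "Cr r T (\<lambda>y. frechet_derivative f (at y) b)" "Cr r S (\<lambda>x. frechet_derivative g (at x) v)"
          using Suc.prems b v by simp_all
        then show "Cr r S (\<lambda>x. frechet_derivative g (at x) v \<bullet> b)"
          "Cr r S (\<lambda>x. frechet_derivative f (at (g x)) b)"
          using Suc.IH[of "\<lambda>y. frechet_derivative f (at y) b", OF _ g]
            Cr_linear_compose[OF assms(1) bounded_linear_inner_left[of b], of r "\<lambda>x. frechet_derivative g (at x) v"]
          by simp_all
      qed
    qed
  qed
qed

lemma C_diff_imp_Cr: "C_diff r g \<Longrightarrow> Cr r UNIV g"
  by (induction r arbitrary: g) (auto simp: Basis_vec_def partial_deriv_def[abs_def])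

section \<open>Straightening a function with nonvanishing derivative\<close>

text \<open>
  The chart turns \<open>g\<close> into the linear coordinate in direction \<open>v\<close> and moves points along \<open>v\<close> only,
  so that it preserves every subspace containing \<open>v\<close>.
\<close>

definition straighten :: "('a::euclidean_space \<Rightarrow> real) \<Rightarrow> 'a \<Rightarrow> 'a \<Rightarrow> 'a" where
  "straighten g v x = x + (g x - x \<bullet> v) *\<^sub>R v"

text \<open>The inverse function theorem yields only a differentiable homeomorphism. The derivative
  of the inverse at \<open>z\<close> is an explicit expression in the derivatives of
  \<open>g\<close> at \<open>\<Psi> z\<close>, so class C^j of \<Psi> gives class C^(j+1) as long as
  j \<le> r.\<close>

lemma straighten_local_inverse:
  fixes g :: "'a::euclidean_space \<Rightarrow> real"
  assumes S: "open S" and g: "Cr (Suc r) S g" and a: "a \<in> S" and v: "norm v = 1"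
    and nz: "frechet_derivative g (at a) v \<noteq> 0"
  obtains U Q \<Psi> where "open U" "a \<in> U" "U \<subseteq> S" "open Q"
    "\<And>x. x \<in> U \<Longrightarrow> straighten g v x \<in> Q \<and> \<Psi> (straighten g v x) = x"
    "\<And>z. z \<in> Q \<Longrightarrow> \<Psi> z \<in> U \<and> straighten g v (\<Psi> z) = z"
    "Cr (Suc r) Q \<Psi>"
    "\<And>x. x \<in> U \<Longrightarrow> frechet_derivative g (at x) v \<noteq> 0"
proof -
  define D where "D = (\<lambda>x. frechet_derivative g (at x))"
  have vv: "v \<bullet> v = 1"
    using v by (simp add: dot_square_norm)
  have Dg: "(g has_derivative D x) (at x)" if "x \<in> S" for x
    using Cr_has_derivative[OF g that] by (simp add: D_def)
  then have bl: "bounded_linear (D x)" if "x \<in> S" for x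
    using that has_derivative_bounded_linear by blast
  have CD: "Cr r S (\<lambda>x. D x h)" for h
    using Cr_frechet_derivative[OF S g] by (simp add: D_def)
  then have contD: "continuous_on S (\<lambda>x. D x h)" for h
    by (rule Cr_continuous_on)
  define T where "T = {x \<in> S. D x v \<noteq> 0}"
  have "open T"
  proof -
    have "T = S \<inter> (\<lambda>x. D x v) -` (- {0})"
      by (auto simp: T_def)
    then show ?thesis
      using continuous_on_open_vimage[OF S] contD[of v] by (metis open_Compl closed_singleton Int_commute)
  qed
  \<comment> \<open>\<open>F x\<close> is the derivative of the straightening, a rank-one
    perturbation of the identity. \<open>G x\<close> is its inverse by the Sherman-Morrison formula,
    whose denominator 1 + (D x v - v \<bullet> v) equals D x v.\<close>
  define F where "F = (\<lambda>x h. h + (D x h - h \<bullet> v) *\<^sub>R v)"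
  define G where "G = (\<lambda>x k. k + ((k \<bullet> v - D x k) * inverse (D x v)) *\<^sub>R v)"
  have blF: "bounded_linear (F x)" and blG: "bounded_linear (G x)" if "x \<in> S" for x
    unfolding F_def G_def
    by (intro bounded_linear_add bounded_linear_ident bounded_linear_sub bl[OF that] bounded_linear_inner_left
        bounded_linear_scaleR_const bounded_linear_mult_const)+
  have GF: "G x (F x h) = h" and FG: "F x (G x h) = h" if "x \<in> T" for x h
  proof -
    interpret D: bounded_linear "D x" using bl that by (simp add: T_def)
    have nz: "D x v \<noteq> 0" using that by (simp add: T_def)
    have D: "D x (k + c *\<^sub>R v) = D x k + c * D x v" and I: "(k + c *\<^sub>R v) \<bullet> v = k \<bullet> v + c" for k c
      by (simp_all add: D.add D.scaleR inner_add_left vv)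
    show "G x (F x h) = h" "F x (G x h) = h"
      unfolding F_def G_def D I using nz by (simp_all add: algebra_simps)
  qed
  have aT: "a \<in> T"
    using a nz by (simp add: T_def D_def)
  have derF: "(straighten g v has_derivative F x) (at x)" if "x \<in> S" for x
    unfolding straighten_def[abs_def] F_def
    by (auto intro!: derivative_eq_intros Dg[OF that])
  have appF: "blinfun_apply (Blinfun (F x)) = F x" and appG: "blinfun_apply (Blinfun (G x)) = G x"
    if "x \<in> S" for x
    using bounded_linear_Blinfun_apply blF[OF that] blG[OF that] by auto
  have TS: "T \<subseteq> S" by (auto simp: T_def)
  have contF: "continuous_on T (\<lambda>x. Blinfun (F x))"
  proof (rule continuous_on_blinfun_componentwise)
    fix i :: 'a
    have "continuous_on T (\<lambda>x. F x i)"
      unfolding F_def by (intro continuous_intros continuous_on_subset[OF contD TS])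
    then show "continuous_on T (\<lambda>x. blinfun_apply (Blinfun (F x)) i)"
      using TS by (subst continuous_on_cong[OF refl]) (auto simp: appF)
  qed
  obtain U Q \<Psi> \<Psi>' where U: "open U" "U \<subseteq> T" "a \<in> U" and Q: "open Q"
    and hom: "homeomorphism U Q (straighten g v) \<Psi>"
    and der: "\<And>y. y \<in> Q \<Longrightarrow> (\<Psi> has_derivative \<Psi>' y) (at y)"
    and \<Psi>': "\<And>y. y \<in> Q \<Longrightarrow> \<Psi>' y = inv (blinfun_apply (Blinfun (F (\<Psi> y))))"
  proof (rule inverse_function_theorem[OF \<open>open T\<close> _ contF aT])
    show "(straighten g v has_derivative blinfun_apply (Blinfun (F x))) (at x)" if "x \<in> T" for x
      using derF appF that TS by auto
    show "Blinfun (G a) o\<^sub>L Blinfun (F a) = id_blinfun"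
      using a aT by (intro blinfun_eqI) (simp add: appF appG GF)
  qed blast
  have \<Psi>U: "\<Psi> z \<in> U" if "z \<in> Q" for z
    using that hom by (auto simp: homeomorphism_def)
  have der': "(\<Psi> has_derivative G (\<Psi> z)) (at z)" if "z \<in> Q" for z
  proof -
    have T: "\<Psi> z \<in> T" using \<Psi>U[OF that] U by auto
    have "inv (F (\<Psi> z)) = G (\<Psi> z)"
      by (rule inv_equality) (simp_all add: GF FG T)
    then show ?thesis
      using der[OF that] \<Psi>'[OF that] T TS appF by auto
  qed
  have "Cr j Q \<Psi>" if "j \<le> Suc r" for j
    using that
  proof (induction j)
    case 0
    then show ?case using hom by (simp add: homeomorphism_def)
  next
    case (Suc j)
    then have "Cr j Q \<Psi>" and jr: "j \<le> r" by auto
    have comp: "Cr j Q (\<lambda>z. D (\<Psi> z) h)" for h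
      by (rule Cr_compose[OF Q S Cr_le[OF CD jr] \<open>Cr j Q \<Psi>\<close>]) (use \<Psi>U U TS in auto)
    show ?case
    proof (rule Cr_SucI[OF Q der'])
      fix k :: 'a
      show "Cr j Q (\<lambda>z. G (\<Psi> z) k)"
        unfolding G_def
      proof (intro Cr_add Cr_scaleR Cr_mult Cr_minus Cr_inverse Cr_const Q comp)
        show "D (\<Psi> z) v \<noteq> 0" if "z \<in> Q" for z
          using \<Psi>U[OF that] U by (auto simp: T_def)
      qed
    qed
  qed
  then have "Cr (Suc r) Q \<Psi>" by blast
  show thesis
  proof (rule that[OF U(1,3) _ Q _ _ \<open>Cr (Suc r) Q \<Psi>\<close>])
    show "U \<subseteq> S" using U TS by auto
    show "straighten g v x \<in> Q \<and> \<Psi> (straighten g v x) = x" if "x \<in> U" for x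
      using hom that by (auto simp: homeomorphism_def)
    show "\<Psi> z \<in> U \<and> straighten g v (\<Psi> z) = z" if "z \<in> Q" for z
      using hom that by (auto simp: homeomorphism_def)
    show "frechet_derivative g (at x) v \<noteq> 0" if "x \<in> U" for x
      using U that by (auto simp: T_def D_def)
  qed
qed

lemma straighten_inner: "norm v = 1 \<Longrightarrow> straighten g v x \<bullet> v = g x"
  by (simp add: straighten_def inner_add_left dot_square_norm)

lemma straighten_mem_iff:
  assumes "subspace V" "v \<in> V"
  shows "straighten g v x \<in> V \<longleftrightarrow> x \<in> V"
proof -
  have "(g x - x \<bullet> v) *\<^sub>R v \<in> V"
    using assms by (simp add: subspace_mul)
  then show ?thesis
    unfolding straighten_def using assms(1) by (metis add_diff_cancel_right' subspace_add subspace_diff)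
qed

section \<open>Flat decomposition of a compact set\<close>

text \<open>\<open>E\<close> is only required to be bounded, so the radius \<eta> and the bound
  \<open>L\<close> are demanded uniformly. Nearby parameters in \<open>W\<close>, also those outside
  \<open>E\<close>, must be sent into \<open>V\<close>: then the derivatives of \<psi> along
  \<open>W\<close> lie in \<open>V\<close>, where the hypotheses on derivatives apply.\<close>

definition C1_param ::
    "'a::euclidean_space set \<Rightarrow> 'a set \<Rightarrow> 'a set \<Rightarrow> ('a \<Rightarrow> 'a) \<Rightarrow> ('a \<Rightarrow> 'a \<Rightarrow> 'a) \<Rightarrow> real \<Rightarrow> real \<Rightarrow> bool" where
  "C1_param V W E \<psi> \<psi>' L \<eta> \<longleftrightarrow>
     subspace W \<and> dim W \<le> dim V \<and> E \<subseteq> W \<and> bounded E \<and> 0 < \<eta> \<and> 0 < L \<and>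
     (\<forall>x\<in>E. \<forall>y\<in>W. dist x y < \<eta> \<longrightarrow>
        (\<psi> has_derivative \<psi>' y) (at y) \<and> (\<forall>h. norm (\<psi>' y h) \<le> L * norm h) \<and> \<psi> y \<in> V)"

text \<open>
  The point \<open>x\<close> ranges over parameters of points of \<open>A\<close> only, whereas \<open>y\<close> ranges over all nearby points of \<open>W\<close>.
\<close>

definition flat_param ::
    "nat \<Rightarrow> 'a::euclidean_space set \<Rightarrow> 'a set \<Rightarrow> 'a set \<Rightarrow> ('a \<Rightarrow> 'a) \<Rightarrow> bool" where
  "flat_param r A W E \<psi> \<longleftrightarrow>
     (\<forall>S (f::'a \<Rightarrow> real). open S \<and> A \<subseteq> S \<and> Cr r S f \<and> (\<forall>a\<in>A. f a = 0) \<longrightarrow>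
        (\<forall>\<epsilon>>0. \<exists>\<delta>>0. \<forall>x\<in>E. \<forall>y\<in>W. dist x y < \<delta> \<longrightarrow> \<bar>f (\<psi> y)\<bar> \<le> \<epsilon> * dist x y ^ r))"

definition flat_piece ::
    "nat \<Rightarrow> 'a::euclidean_space set \<Rightarrow> 'a set \<Rightarrow> 'a set \<Rightarrow> bool" where
  "flat_piece r V A P \<longleftrightarrow>
     P \<subseteq> A \<and> (\<exists>W E \<psi> \<psi>' L \<eta>. P = \<psi> ` E \<and> C1_param V W E \<psi> \<psi>' L \<eta> \<and> flat_param r A W E \<psi>)"

section \<open>Calculus along parametrized pieces\<close>

lemma finite_ex_pos_uniform:
  fixes P :: "'b \<Rightarrow> real \<Rightarrow> bool"
  assumes "finite B" "\<And>b. b \<in> B \<Longrightarrow> \<exists>\<delta>>0. P b \<delta>" "\<And>b \<delta> \<delta>'. P b \<delta> \<Longrightarrow> 0 < \<delta>' \<Longrightarrow> \<delta>' \<le> \<delta> \<Longrightarrow> P b \<delta>'"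
  shows "\<exists>\<delta>>0. \<forall>b\<in>B. P b \<delta>"
  using assms(1,2)
proof (induction B)
  case empty
  then show ?case by (auto intro: exI[of _ 1])
next
  case (insert b B)
  then obtain \<delta>1 \<delta>2 where "\<delta>1 > 0" "\<forall>b\<in>B. P b \<delta>1" "\<delta>2 > 0" "P b \<delta>2"
    by (metis insertCI)
  then show ?case
    by (intro exI[of _ "min \<delta>1 \<delta>2"]) (auto intro: assms(3))
qed

text \<open>\<open>D k\<close> is the limit of difference quotients in the direction
  \<open>k\<close>; these lie in \<open>V\<close>, and a subspace is closed.\<close>

lemma derivative_in_subspace:
  fixes \<psi> :: "'a::real_normed_vector \<Rightarrow> 'b::euclidean_space"
  assumes "subspace V" "(\<psi> has_derivative D) (at z)" "0 < e"
    and "\<And>t. \<bar>t\<bar> < e \<Longrightarrow> \<psi> (z + t *\<^sub>R k) \<in> V"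
  shows "D k \<in> V"
proof -
  have "((\<lambda>t::real. z + t *\<^sub>R k) has_derivative (\<lambda>t. t *\<^sub>R k)) (at 0)"
    by (auto intro!: derivative_eq_intros)
  moreover have "(\<psi> has_derivative D) (at (z + (0::real) *\<^sub>R k))"
    using assms(2) by simp
  ultimately have "((\<lambda>t::real. \<psi> (z + t *\<^sub>R k)) has_derivative (\<lambda>t. D (t *\<^sub>R k))) (at 0)"
    by (rule has_derivative_compose)
  moreover have "D (t *\<^sub>R k) = t *\<^sub>R D k" for t
    using assms(2) has_derivative_linear linear_cmul by blast
  ultimately have lim0: "((\<lambda>t::real. norm (\<psi> (z + t *\<^sub>R k) - \<psi> z - t *\<^sub>R D k) / norm t) \<longlongrightarrow> 0) (at 0)"
    by (simp add: has_derivative_at)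
  have "((\<lambda>t. inverse t *\<^sub>R (\<psi> (z + t *\<^sub>R k) - \<psi> z) - D k) \<longlongrightarrow> 0) (at 0)"
  proof (rule tendsto_norm_zero_cancel, rule Lim_transform_eventually[OF lim0])
    have "norm (\<psi> (z + t *\<^sub>R k) - \<psi> z - t *\<^sub>R D k) / norm t =
        norm (inverse t *\<^sub>R (\<psi> (z + t *\<^sub>R k) - \<psi> z) - D k)" if "t \<noteq> 0" for t :: real
    proof -
      have "inverse t *\<^sub>R (\<psi> (z + t *\<^sub>R k) - \<psi> z) - D k = inverse t *\<^sub>R (\<psi> (z + t *\<^sub>R k) - \<psi> z - t *\<^sub>R D k)"
        using that by (simp add: scaleR_diff_right)
      then show ?thesis
        by (simp add: divide_inverse mult.commute)
    qed
    then show "\<forall>\<^sub>F t in at 0. norm (\<psi> (z + t *\<^sub>R k) - \<psi> z - t *\<^sub>R D k) / norm t =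
        norm (inverse t *\<^sub>R (\<psi> (z + t *\<^sub>R k) - \<psi> z) - D k)"
      by (auto simp: eventually_at_filter)
  qed
  then have lim: "((\<lambda>t. inverse t *\<^sub>R (\<psi> (z + t *\<^sub>R k) - \<psi> z)) \<longlongrightarrow> D k) (at 0)"
    by (simp add: Lim_null[symmetric] LIM_zero_iff)
  show ?thesis
  proof (rule Lim_in_closed_set[OF closed_subspace[OF assms(1)] _ _ lim])
    have "\<forall>\<^sub>F t in at (0::real). \<bar>t\<bar> < e"
      using assms(3) by (auto simp: eventually_at intro!: exI[of _ e])
    then show "\<forall>\<^sub>F t in at 0. inverse t *\<^sub>R (\<psi> (z + t *\<^sub>R k) - \<psi> z) \<in> V"
    proof eventually_elim
      case (elim t)
      then show ?case
        using assms(4)[of t] assms(4)[of 0] assms(1,3) by (simp add: subspace_diff subspace_mul)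
    qed
  qed simp
qed

lemma C1_param_derivative_mem:
  assumes "C1_param V W E \<psi> \<psi>' L \<eta>" "subspace V" "x \<in> E" "z \<in> W" "dist x z < \<eta>" "k \<in> W"
  shows "\<psi>' z k \<in> V"
\<comment> \<open>The range for \<open>t\<close> keeps z + t k within \<eta> of \<open>x\<close>;
  the 1 in the denominator covers k = 0.\<close>
proof (rule derivative_in_subspace[OF assms(2), where \<psi> = \<psi> and z = z and D = "\<psi>' z" and k = k and e = "(\<eta> - dist x z) / (norm k + 1)"])
  show "(\<psi> has_derivative \<psi>' z) (at z)"
    using assms unfolding C1_param_def by blast
  show "0 < (\<eta> - dist x z) / (norm k + 1)"
    using assms(5) by (simp add: add_nonneg_pos)
  show "\<psi> (z + t *\<^sub>R k) \<in> V" if "\<bar>t\<bar> < (\<eta> - dist x z) / (norm k + 1)" for t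
  proof -
    define e where "e = (\<eta> - dist x z) / (norm k + 1)"
    have W: "z + t *\<^sub>R k \<in> W"
      using assms unfolding C1_param_def by (simp add: subspace_add subspace_mul)
    have "\<bar>t\<bar> * norm k \<le> \<bar>t\<bar> * (norm k + 1)"
      by (simp add: mult_left_mono)
    also have "\<dots> < e * (norm k + 1)"
      using that by (intro mult_strict_right_mono) (auto simp: e_def add_nonneg_pos)
    also have "\<dots> = \<eta> - dist x z"
    proof -
      have "norm k + 1 \<noteq> 0" by (smt (verit) norm_ge_zero)
      then show ?thesis by (simp add: e_def)
    qed
    finally have "dist z (z + t *\<^sub>R k) < \<eta> - dist x z"
      by (simp add: dist_norm)
    then have "dist x (z + t *\<^sub>R k) < \<eta>"
      using dist_triangle[of x "z + t *\<^sub>R k" z] by linarith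
    with W show ?thesis
      using assms(1,3) unfolding C1_param_def by blast
  qed
qed

lemma closed_segment_subspace:
  "subspace W \<Longrightarrow> x \<in> W \<Longrightarrow> y \<in> W \<Longrightarrow> closed_segment x y \<subseteq> W"
  by (simp add: closed_segment_subset subspace_imp_convex)

text \<open>The mean value inequality on the segment from \<open>x\<close> to \<open>y\<close>,
  which stays in \<open>W\<close> and within \<eta> of \<open>x\<close>.\<close>

lemma C1_param_Lipschitz:
  assumes C: "C1_param V W E \<psi> \<psi>' L \<eta>" and x: "x \<in> E" and y: "y \<in> W" and d: "dist x y < \<eta>"
  shows "dist (\<psi> x) (\<psi> y) \<le> L * dist x y"
proof -
  have "norm (\<psi> x - \<psi> y) \<le> L * norm (x - y)"
  proof (rule differentiable_bound[where S="closed_segment x y" and f'=\<psi>'])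
    fix z assume z: "z \<in> closed_segment x y"
    have "z \<in> W"
      using z C x y closed_segment_subspace[of W x y] unfolding C1_param_def by auto
    moreover have "dist x z < \<eta>"
      using z d dist_in_closed_segment[of z x y] by (simp add: dist_commute)
    ultimately have *: "(\<psi> has_derivative \<psi>' z) (at z)" "\<And>h. norm (\<psi>' z h) \<le> L * norm h" and "0 < L"
      using C x unfolding C1_param_def by blast+
    show "(\<psi> has_derivative \<psi>' z) (at z within closed_segment x y)"
      using * has_derivative_at_withinI by blast
    show "onorm (\<psi>' z) \<le> L"
      using * \<open>0 < L\<close> by (intro onorm_bound) auto
  qed auto
  then show ?thesis by (simp add: dist_norm)
qed

lemma linear_bound_orthonormal:
  fixes D :: "'a::euclidean_space \<Rightarrow> real"
  assumes "linear D" "pairwise orthogonal B" "\<And>b. b \<in> B \<Longrightarrow> norm b = 1" "finite B" "h \<in> span B"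
    and "\<And>b. b \<in> B \<Longrightarrow> \<bar>D b\<bar> \<le> M"
  shows "\<bar>D h\<bar> \<le> real (card B) * M * norm h"
proof -
  have "D h = D (\<Sum>b\<in>B. (h \<bullet> b) *\<^sub>R b)"
    using orthonormal_basis_expand[OF assms(2,3,5,4)] by simp
  also have "\<dots> = (\<Sum>b\<in>B. (h \<bullet> b) * D b)"
    using assms(1) by (simp add: linear_sum linear_cmul)
  also have "\<bar>\<dots>\<bar> \<le> (\<Sum>b\<in>B. norm h * M)"
  proof (rule order_trans[OF sum_abs sum_mono])
    fix b assume b: "b \<in> B"
    have "\<bar>h \<bullet> b\<bar> \<le> norm h"
      using Cauchy_Schwarz_ineq2[of h b] assms(3)[OF b] by simp
    then show "\<bar>(h \<bullet> b) * D b\<bar> \<le> norm h * M"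
      using assms(6)[OF b] by (simp add: abs_mult mult_mono)
  qed
  finally show ?thesis by (simp add: mult_ac)
qed

text \<open>
  Integrating the estimate for the derivatives along segments of \<open>W\<close> gains one order of flatness.
\<close>

lemma flat_param_integrate:
  fixes f :: "'a::euclidean_space \<Rightarrow> real"
  assumes C: "C1_param V W E \<psi> \<psi>' L \<eta>" and F: "flat_param r A W E \<psi>" and V: "subspace V"
    and A: "compact A" "\<psi> ` E \<subseteq> A" and S: "open S" "A \<subseteq> S" and f: "Cr (Suc r) S f"
    and D0: "\<And>a v. a \<in> A \<Longrightarrow> v \<in> V \<Longrightarrow> frechet_derivative f (at a) v = 0"
    and "\<epsilon> > 0"
  shows "\<exists>\<delta>>0. \<forall>x\<in>E. \<forall>y\<in>W. dist x y < \<delta> \<longrightarrow> \<bar>f (\<psi> y) - f (\<psi> x)\<bar> \<le> \<epsilon> * dist x y ^ Suc r"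
proof -
  define D where "D = (\<lambda>x. frechet_derivative f (at x))"
  have W: "subspace W" and "0 < L" "0 < \<eta>" and EW: "E \<subseteq> W"
    using C by (auto simp: C1_param_def)
  obtain B where B: "B \<subseteq> V" "pairwise orthogonal B" "\<And>b. b \<in> B \<Longrightarrow> norm b = 1" "independent B"
    "span B = V"
    using orthonormal_basis_subspace[OF V] by metis
  have finB: "finite B" using B(4) independent_imp_finite by blast
  \<comment> \<open>The chain rule below costs a factor \<open>card B\<close> for expanding the
    derivative of \<open>f\<close> over the orthonormal basis of \<open>V\<close>, and a factor
    \<open>L\<close> for \<psi>'. The 1 keeps the denominator positive when \<open>V\<close> is
    trivial.\<close>
  define \<epsilon>' where "\<epsilon>' = \<epsilon> / (real (card B) * L + 1)"
  have cL: "real (card B) * L + 1 > 0" using \<open>0 < L\<close> by (simp add: add_nonneg_pos)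
  have "\<epsilon>' > 0" using \<open>\<epsilon> > 0\<close> cL by (simp add: \<epsilon>'_def)
  have "\<exists>\<delta>>0. \<forall>b\<in>B. \<forall>x\<in>E. \<forall>y\<in>W. dist x y < \<delta> \<longrightarrow> \<bar>D (\<psi> y) b\<bar> \<le> \<epsilon>' * dist x y ^ r"
  proof (rule finite_ex_pos_uniform[OF finB])
    fix b assume b: "b \<in> B"
    have 1: "Cr r S (\<lambda>x. D x b)"
      unfolding D_def using Cr_frechet_derivative[OF S(1) f] .
    have 2: "\<forall>a\<in>A. D a b = 0"
      using D0 b B(1) by (auto simp: D_def)
    show "\<exists>\<delta>>0. \<forall>x\<in>E. \<forall>y\<in>W. dist x y < \<delta> \<longrightarrow> \<bar>D (\<psi> y) b\<bar> \<le> \<epsilon>' * dist x y ^ r"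
      using F[unfolded flat_param_def, rule_format, of S "\<lambda>x. D x b" \<epsilon>'] S 1 2 \<open>\<epsilon>' > 0\<close> by simp
  qed auto
  then obtain \<delta>1 where "\<delta>1 > 0"
    and \<delta>1: "\<And>b x y. b \<in> B \<Longrightarrow> x \<in> E \<Longrightarrow> y \<in> W \<Longrightarrow> dist x y < \<delta>1 \<Longrightarrow> \<bar>D (\<psi> y) b\<bar> \<le> \<epsilon>' * dist x y ^ r"
    by metis
  obtain e where "e > 0" and e: "(\<Union>x\<in>A. ball x e) \<subseteq> S"
    using compact_subset_open_imp_ball_epsilon_subset[OF A(1) S] .
  \<comment> \<open>The bound e / L keeps the path in the open set \<open>S\<close>: a parameter at
    that distance from \<open>x\<close> is mapped less than \<open>e\<close> away from a point of
    \<open>A\<close>.\<close>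
  define \<delta> where "\<delta> = min \<delta>1 (min \<eta> (e / L))"
  have "\<delta> > 0"
    using \<open>\<delta>1 > 0\<close> \<open>0 < \<eta>\<close> \<open>e > 0\<close> \<open>0 < L\<close> by (simp add: \<delta>_def)
  moreover have "\<bar>f (\<psi> y) - f (\<psi> x)\<bar> \<le> \<epsilon> * dist x y ^ Suc r"
    if x: "x \<in> E" and y: "y \<in> W" and d: "dist x y < \<delta>" for x y
  proof -
    define z where "z = (\<lambda>t::real. x + t *\<^sub>R (y - x))"
    define \<phi>' where "\<phi>' = (\<lambda>t. D (\<psi> (z t)) (\<psi>' (z t) (y - x)))"
    define M where "M = \<epsilon> * dist x y ^ Suc r"
    have k: "y - x \<in> W" using x y EW W by (auto intro: subspace_diff)
    have bound: "((\<lambda>t. f (\<psi> (z t))) has_field_derivative \<phi>' t) (at t within {0..1}) \<and> \<bar>\<phi>' t\<bar> \<le> M"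
      if t: "t \<in> {0..1}" for t
    proof -
      have zW: "z t \<in> W"
        unfolding z_def using x EW k W by (auto intro: subspace_add subspace_mul)
      have "dist x (z t) = t * dist x y"
        using t by (simp add: z_def dist_norm norm_minus_commute)
      also have "\<dots> \<le> 1 * dist x y"
        using t by (intro mult_right_mono) auto
      finally have dz: "dist x (z t) \<le> dist x y" by simp
      have z\<eta>: "dist x (z t) < \<eta>" and z1: "dist x (z t) < \<delta>1" and zL: "dist x (z t) < e / L"
        using dz d by (auto simp: \<delta>_def)
      have der: "(\<psi> has_derivative \<psi>' (z t)) (at (z t))" and L: "norm (\<psi>' (z t) (y - x)) \<le> L * norm (y - x)"
        using C x zW z\<eta> unfolding C1_param_def by blast+
      have "dist (\<psi> x) (\<psi> (z t)) \<le> L * dist x (z t)"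
        by (rule C1_param_Lipschitz[OF C x zW z\<eta>])
      also have "\<dots> < e"
        using zL \<open>0 < L\<close> by (simp add: field_simps)
      finally have "\<psi> (z t) \<in> S"
        using e x A(2) by (auto simp: subset_eq)
      then have Df: "(f has_derivative D (\<psi> (z t))) (at (\<psi> (z t)))"
        unfolding D_def by (rule Cr_has_derivative[OF f])
      have "(z has_derivative (\<lambda>\<tau>. \<tau> *\<^sub>R (y - x))) (at t within {0..1})"
        unfolding z_def by (auto intro!: derivative_eq_intros)
      from has_derivative_compose[OF has_derivative_compose[OF this der] Df]
      have "((\<lambda>t. f (\<psi> (z t))) has_derivative (\<lambda>\<tau>. D (\<psi> (z t)) (\<psi>' (z t) (\<tau> *\<^sub>R (y - x))))) (at t within {0..1})" .
      moreover have "D (\<psi> (z t)) (\<psi>' (z t) (\<tau> *\<^sub>R (y - x))) = \<tau> * \<phi>' t" for \<tau>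
        using linear_cmul[OF has_derivative_linear[OF der]] linear_cmul[OF has_derivative_linear[OF Df]]
        by (simp add: \<phi>'_def)
      ultimately have 1: "((\<lambda>t. f (\<psi> (z t))) has_field_derivative \<phi>' t) (at t within {0..1})"
        by (simp add: has_field_derivative_def mult_commute_abs)
      \<comment> \<open>Flatness controls the derivative of \<open>f\<close> along \<open>V\<close>
        only, so the velocity of the path has to lie in \<open>V\<close>.\<close>
      have "\<psi>' (z t) (y - x) \<in> span B"
        using C1_param_derivative_mem[OF C V x zW z\<eta> k] B(5) by simp
      then have "\<bar>\<phi>' t\<bar> \<le> real (card B) * (\<epsilon>' * dist x (z t) ^ r) * norm (\<psi>' (z t) (y - x))"
        unfolding \<phi>'_def
        by (intro linear_bound_orthonormal[OF has_derivative_linear[OF Df] B(2,3) finB] \<delta>1 x zW z1)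
      also have "\<dots> \<le> real (card B) * (\<epsilon>' * dist x y ^ r) * (L * dist x y)"
        using L \<open>\<epsilon>' > 0\<close> dz
        by (intro mult_mono mult_nonneg_nonneg power_mono) (auto simp: dist_norm norm_minus_commute)
      also have "\<dots> = (real (card B) * L) * \<epsilon>' * dist x y ^ Suc r"
        by simp
      also have "\<dots> \<le> (real (card B) * L + 1) * \<epsilon>' * dist x y ^ Suc r"
        using \<open>\<epsilon>' > 0\<close> by (intro mult_right_mono) auto
      also have "\<dots> = M"
        using cL by (simp add: \<epsilon>'_def M_def)
      finally show ?thesis using 1 by simp
    qed
    have "norm (f (\<psi> (z 1)) - f (\<psi> (z 0))) \<le> M * norm (1 - 0 :: real)"
      by (rule field_differentiable_bound[of "{0..1}" _ \<phi>']) (use bound in auto)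
    then show ?thesis
      by (simp add: z_def M_def)
  qed
  ultimately show ?thesis by blast
qed

section \<open>Transport of flat pieces by charts\<close>

lemma compact_cball_neighbourhood:
  fixes A :: "'a::euclidean_space set"
  assumes "compact A"
  shows "compact (\<Union>x\<in>A. cball x e)"
proof -
  have "(\<Union>x\<in>A. cball x e) = {x + y |x y. x \<in> A \<and> y \<in> cball 0 e}"
  proof (intro set_eqI iffI)
    fix z assume "z \<in> (\<Union>x\<in>A. cball x e)"
    then obtain x where "x \<in> A" "dist x z \<le> e" by auto
    then have "z = x + (z - x)" "z - x \<in> cball 0 e"
      by (auto simp: dist_norm norm_minus_commute)
    with \<open>x \<in> A\<close> show "z \<in> {x + y |x y. x \<in> A \<and> y \<in> cball 0 e}" by blast
  next
    fix z assume "z \<in> {x + y |x y. x \<in> A \<and> y \<in> cball 0 e}"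
    then obtain x y where "x \<in> A" "norm y \<le> e" "z = x + y" by auto
    then show "z \<in> (\<Union>x\<in>A. cball x e)"
      by (intro UN_I[of x]) (auto simp: dist_norm)
  qed
  then show ?thesis
    using compact_sums[OF assms compact_cball[of 0 e]] by (simp only:)
qed

lemma Cr_derivative_bounded_on_compact:
  fixes f :: "'a::euclidean_space \<Rightarrow> 'b::real_normed_vector"
  assumes "Cr (Suc r) S f" "compact K" "K \<subseteq> S"
  obtains M where "0 < M" "\<And>z h. z \<in> K \<Longrightarrow> norm (frechet_derivative f (at z) h) \<le> M * norm h"
proof -
  have "\<exists>M. \<forall>z\<in>K. norm (frechet_derivative f (at z) b) \<le> M" if "b \<in> Basis" for b
  proof -
    have "Cr r S (\<lambda>z. frechet_derivative f (at z) b)"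
      using assms(1) that by simp
    then have "continuous_on K (\<lambda>z. frechet_derivative f (at z) b)"
      using Cr_continuous_on continuous_on_subset assms(3) by blast
    then have "bounded ((\<lambda>z. frechet_derivative f (at z) b) ` K)"
      using assms(2) compact_continuous_image compact_imp_bounded by blast
    then show ?thesis
      by (auto simp: bounded_iff)
  qed
  then obtain m where m: "\<And>b z. b \<in> Basis \<Longrightarrow> z \<in> K \<Longrightarrow> norm (frechet_derivative f (at z) b) \<le> m b"
    by metis
  define M where "M = 1 + (\<Sum>b\<in>Basis. \<bar>m b\<bar>)"
  show thesis
  proof (rule that[of M])
    show "0 < M" by (simp add: M_def add_pos_nonneg sum_nonneg)
    fix z h assume z: "z \<in> K"
    then have "linear (frechet_derivative f (at z))"
      using assms by (intro linear_frechet_derivative) auto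
    then have "frechet_derivative f (at z) h = (\<Sum>b\<in>Basis. (h \<bullet> b) *\<^sub>R frechet_derivative f (at z) b)"
      by (rule linear_Basis_expansion)
    also have "norm \<dots> \<le> (\<Sum>b\<in>Basis. norm h * \<bar>m b\<bar>)"
    proof (rule order_trans[OF norm_sum sum_mono])
      fix b :: 'a assume b: "b \<in> Basis"
      have "norm (frechet_derivative f (at z) b) \<le> \<bar>m b\<bar>"
        using m[OF b z] by linarith
      then show "norm ((h \<bullet> b) *\<^sub>R frechet_derivative f (at z) b) \<le> norm h * \<bar>m b\<bar>"
        using Basis_le_norm[OF b, of h] by (simp add: mult_mono)
    qed
    also have "\<dots> \<le> M * norm h"
      by (simp add: M_def sum_distrib_left[symmetric] algebra_simps)
    finally show "norm (frechet_derivative f (at z) h) \<le> M * norm h" .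
  qed
qed

text \<open>A function vanishing on \<open>A\<close> pulls back along \<Psi> to a function of the
  same class vanishing on \<open>A'\<close>, so flatness is inherited without loss of order. The
  derivative bound survives because \<Psi> has bounded derivative on a compact neighbourhood of
  \<open>A'\<close>.\<close>

lemma flat_piece_transfer:
  fixes \<Psi> :: "'a::euclidean_space \<Rightarrow> 'a"
  assumes Q: "open Q" and \<Psi>: "Cr (Suc r) Q \<Psi>"
    and \<Psi>V: "\<And>z. z \<in> V \<Longrightarrow> z \<in> Q \<Longrightarrow> \<Psi> z \<in> V" and V': "V' \<subseteq> V"
    and A': "compact A'" "A' \<subseteq> Q" and A: "\<Psi> ` A' \<subseteq> A" and P: "flat_piece (Suc r) V' A' P"
  shows "flat_piece (Suc r) V A (\<Psi> ` P)"
proof -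
  obtain W E \<psi> \<psi>' L \<eta> where "P \<subseteq> A'" and PE: "P = \<psi> ` E" and C: "C1_param V' W E \<psi> \<psi>' L \<eta>"
    and F: "flat_param (Suc r) A' W E \<psi>"
    using P unfolding flat_piece_def by auto
  have "0 < L" "0 < \<eta>" using C by (auto simp: C1_param_def)
  obtain e where "e > 0" and e: "(\<Union>x\<in>A'. cball x e) \<subseteq> Q"
    using compact_subset_open_imp_cball_epsilon_subset[OF A'(1) Q A'(2)] .
  obtain M where "0 < M"
    and M: "\<And>z h. z \<in> (\<Union>x\<in>A'. cball x e) \<Longrightarrow> norm (frechet_derivative \<Psi> (at z) h) \<le> M * norm h"
    by (rule Cr_derivative_bounded_on_compact[OF \<Psi> compact_cball_neighbourhood[OF A'(1)] e]) blast
  \<comment> \<open>By the Lipschitz bound, parameters within e / L of \<open>E\<close> are sent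
    into the closed \<open>e\<close>-neighbourhood of \<open>A'\<close>, where \<open>M\<close>
    bounds the derivative of \<Psi>.\<close>
  define \<eta>2 where "\<eta>2 = min \<eta> (e / L)"
  have "C1_param V W E (\<Psi> \<circ> \<psi>) (\<lambda>y h. frechet_derivative \<Psi> (at (\<psi> y)) (\<psi>' y h)) (M * L) \<eta>2"
    unfolding C1_param_def
  proof (intro conjI ballI impI allI)
    show "subspace W" "E \<subseteq> W" "bounded E"
      using C by (auto simp: C1_param_def)
    show "dim W \<le> dim V"
      using C dim_subset[OF V'] by (auto simp: C1_param_def)
    show "0 < \<eta>2" "0 < M * L"
      using \<open>0 < L\<close> \<open>0 < \<eta>\<close> \<open>0 < e\<close> \<open>0 < M\<close> by (auto simp: \<eta>2_def)
    fix x y assume xy: "x \<in> E" "y \<in> W" "dist x y < \<eta>2"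
    then have d: "dist x y < \<eta>" and dL: "L * dist x y < e"
      using \<open>0 < L\<close> by (auto simp: \<eta>2_def field_simps)
    have der: "(\<psi> has_derivative \<psi>' y) (at y)" and bd: "\<And>h. norm (\<psi>' y h) \<le> L * norm h" and V'y: "\<psi> y \<in> V'"
      using C xy(1,2) d unfolding C1_param_def by blast+
    have "dist (\<psi> x) (\<psi> y) \<le> e"
      using C1_param_Lipschitz[OF C xy(1,2) d] dL by linarith
    then have K: "\<psi> y \<in> (\<Union>x\<in>A'. cball x e)"
      using xy(1) PE \<open>P \<subseteq> A'\<close> by auto
    then have \<psi>Q: "\<psi> y \<in> Q" using e by blast
    show "(\<Psi> \<circ> \<psi> has_derivative (\<lambda>h. frechet_derivative \<Psi> (at (\<psi> y)) (\<psi>' y h))) (at y)"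
      unfolding o_def by (rule has_derivative_compose[OF der Cr_has_derivative[OF \<Psi> \<psi>Q]])
    show "(\<Psi> \<circ> \<psi>) y \<in> V"
      using \<Psi>V[of "\<psi> y"] V'y V' \<psi>Q by auto
    fix h
    have "norm (frechet_derivative \<Psi> (at (\<psi> y)) (\<psi>' y h)) \<le> M * norm (\<psi>' y h)"
      by (rule M[OF K])
    also have "\<dots> \<le> M * (L * norm h)"
      using bd \<open>0 < M\<close> by (intro mult_left_mono) auto
    finally show "norm (frechet_derivative \<Psi> (at (\<psi> y)) (\<psi>' y h)) \<le> M * L * norm h"
      by simp
  qed
  moreover have "flat_param (Suc r) A W E (\<Psi> \<circ> \<psi>)"
    unfolding flat_param_def
  proof (intro allI impI)
    fix S and f :: "'a \<Rightarrow> real" and \<epsilon> :: real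
    assume f: "open S \<and> A \<subseteq> S \<and> Cr (Suc r) S f \<and> (\<forall>a\<in>A. f a = 0)" and "\<epsilon> > 0"
    define T where "T = Q \<inter> \<Psi> -` S"
    have "open T"
      unfolding T_def using continuous_open_preimage[OF Cr_continuous_on[OF \<Psi>] Q] f by blast
    moreover have "A' \<subseteq> T"
      using A A' f by (auto simp: T_def)
    moreover have "Cr (Suc r) T (\<lambda>z. f (\<Psi> z))"
    proof (rule Cr_compose[where f = f and g = \<Psi>, OF \<open>open T\<close>])
      show "Cr (Suc r) T \<Psi>"
        by (rule Cr_subset[OF \<Psi>]) (simp add: T_def)
      show "\<Psi> ` T \<subseteq> S" by (auto simp: T_def)
    qed (use f in auto)
    moreover have "\<forall>a\<in>A'. f (\<Psi> a) = 0"
      using f A by auto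
    ultimately show "\<exists>\<delta>>0. \<forall>x\<in>E. \<forall>y\<in>W. dist x y < \<delta> \<longrightarrow> \<bar>f ((\<Psi> \<circ> \<psi>) y)\<bar> \<le> \<epsilon> * dist x y ^ Suc r"
      using F[unfolded flat_param_def, rule_format, of T "\<lambda>z. f (\<Psi> z)" \<epsilon>] \<open>\<epsilon> > 0\<close> by simp
  qed
  moreover have "\<Psi> ` P = (\<Psi> \<circ> \<psi>) ` E" "\<Psi> ` P \<subseteq> A"
    using PE A \<open>P \<subseteq> A'\<close> by auto
  ultimately show ?thesis
    unfolding flat_piece_def by blast
qed

text \<open>Order 0 asks only for uniform smallness near \<open>A\<close>, which continuity and
  compactness give; the identity serves as parametrization.\<close>

lemma flat_piece_0:
  fixes V :: "'a::euclidean_space set"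
  assumes "subspace V" "compact A" "A \<subseteq> V"
  shows "flat_piece 0 V A A"
proof -
  have "flat_param 0 A V A (\<lambda>x. x)"
    unfolding flat_param_def
  proof (intro allI impI)
    fix S and f :: "'a \<Rightarrow> real" and \<epsilon> :: real
    assume f: "open S \<and> A \<subseteq> S \<and> Cr 0 S f \<and> (\<forall>a\<in>A. f a = 0)" and "\<epsilon> > 0"
    have "open (S \<inter> f -` {-\<epsilon><..<\<epsilon>})"
      using f by (intro continuous_open_preimage) auto
    moreover have "A \<subseteq> S \<inter> f -` {-\<epsilon><..<\<epsilon>}"
      using f \<open>\<epsilon> > 0\<close> by auto
    ultimately obtain e where "e > 0" "(\<Union>x\<in>A. ball x e) \<subseteq> S \<inter> f -` {-\<epsilon><..<\<epsilon>}"
      using compact_subset_open_imp_ball_epsilon_subset[OF assms(2)] by blast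
    then show "\<exists>\<delta>>0. \<forall>x\<in>A. \<forall>y\<in>V. dist x y < \<delta> \<longrightarrow> \<bar>f y\<bar> \<le> \<epsilon> * dist x y ^ 0"
      by (intro exI[of _ e]) (force simp: subset_eq)
  qed
  moreover have "C1_param V V A (\<lambda>x. x) (\<lambda>x h. h) 1 1"
    using assms by (auto simp: C1_param_def compact_imp_bounded intro!: derivative_eq_intros)
  ultimately show ?thesis
    unfolding flat_piece_def by (intro conjI exI[of _ V] exI[of _ A] exI[of _ "\<lambda>x. x"]) auto
qed

text \<open>The property \<open>R\<close> is arbitrary because the passage from local covers to a
  countable one is made twice: for flat pieces and for sets with negligible cylinder.\<close>

lemma countable_family_Lindelof:
  fixes X :: "'a::second_countable_topology set"
  assumes "\<And>a. a \<in> X \<Longrightarrow> \<exists>U \<P>. open U \<and> a \<in> U \<and> countable \<P> \<and> X \<inter> U \<subseteq> \<Union>\<P> \<and> (\<forall>P\<in>\<P>. R P)"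
  shows "\<exists>\<P>. countable \<P> \<and> X \<subseteq> \<Union>\<P> \<and> (\<forall>P\<in>\<P>. R P)"
proof -
  obtain U \<P> where U: "\<And>a. a \<in> X \<Longrightarrow> open (U a) \<and> a \<in> U a \<and> countable (\<P> a) \<and> X \<inter> U a \<subseteq> \<Union>(\<P> a) \<and> (\<forall>P\<in>\<P> a. R P)"
    using assms by metis
  obtain \<U> where \<U>: "\<U> \<subseteq> U ` X" "countable \<U>" "\<Union>\<U> = \<Union>(U ` X)"
    using Lindelof[of "U ` X"] U by auto
  then obtain Y where Y: "Y \<subseteq> X" "countable Y" "\<U> = U ` Y"
    by (metis countable_subset_image)
  show ?thesis
  proof (intro exI[of _ "\<Union>a\<in>Y. \<P> a"] conjI)
    show "countable (\<Union>a\<in>Y. \<P> a)" using Y U by auto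
    show "\<forall>P\<in>\<Union>a\<in>Y. \<P> a. R P" using Y U by auto
    show "X \<subseteq> \<Union> (\<Union>a\<in>Y. \<P> a)"
    proof
      fix x assume "x \<in> X"
      then have "x \<in> \<Union>\<U>" unfolding \<U>(3) using U[OF \<open>x \<in> X\<close>] by blast
      then obtain a where "a \<in> Y" "x \<in> U a" using Y by auto
      then show "x \<in> \<Union> (\<Union>a\<in>Y. \<P> a)" using U[of a] Y \<open>x \<in> X\<close> by auto
    qed
  qed
qed

lemma linear_normalize:
  fixes D :: "'a::real_normed_vector \<Rightarrow> real"
  assumes "linear D" "subspace V" "v \<in> V" "D v \<noteq> 0"
  obtains u where "u \<in> V" "norm u = 1" "D u \<noteq> 0"
proof (rule that[of "(1 / norm v) *\<^sub>R v"])
  have "v \<noteq> 0" using assms(1,4) linear_0 by auto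
  then show "(1 / norm v) *\<^sub>R v \<in> V" "norm ((1 / norm v) *\<^sub>R v) = 1" "D ((1 / norm v) *\<^sub>R v) \<noteq> 0"
    using assms by (auto simp: subspace_mul linear_cmul)
qed

lemma subspace_hyperplane_section:
  assumes "subspace V"
  shows "subspace (V \<inter> {x. x \<bullet> v = 0})"
  using assms subspace_inter[OF _ subspace_hyperplane[of v]] by (simp add: inner_commute)

lemma dim_hyperplane_section:
  fixes V :: "'a::euclidean_space set"
  assumes "subspace V" "v \<in> V" "norm v = 1"
  shows "dim (V \<inter> {x. x \<bullet> v = 0}) < dim V"
proof (rule dim_psubset)
  have "v \<bullet> v \<noteq> 0" using assms(3) by auto
  then have "V \<inter> {x. x \<bullet> v = 0} \<noteq> V" using assms(2) by blast
  then show "span (V \<inter> {x. x \<bullet> v = 0}) \<subset> span V"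
    using assms subspace_hyperplane_section[OF assms(1), of v] by (auto simp: span_eq_iff[THEN iffD2])
qed

text \<open>
  A form of the Kneser--Glaeser--Morse lemma. Points at which some function of class C^(r+1)
  vanishing on \<open>A\<close> has a nonzero derivative along \<open>V\<close> are moved by a chart into a subspace of smaller
  dimension. At all other points the derivatives along \<open>V\<close> of the functions vanishing on \<open>A\<close> vanish
  as well, and one integrates the estimate of order \<open>r\<close>.
\<close>

theorem flat_decomposition:
  fixes A V :: "'a::euclidean_space set"
  assumes "subspace V" "compact A" "A \<subseteq> V"
  shows "\<exists>\<P>. countable \<P> \<and> A \<subseteq> \<Union>\<P> \<and> (\<forall>P\<in>\<P>. flat_piece r V A P)"
  using assms
\<comment> \<open>The outer induction keeps the order arbitrary, the inner one is on the order:
  charts lower the dimension at the same order, integration raises the order at the same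
  \<open>V\<close>.\<close>
proof (induction "dim V" arbitrary: V A r rule: less_induct)
  case less
  note outer = less.hyps
  show ?case
    using less.prems
  proof (induction r arbitrary: A)
    case 0
    then show ?case
      using flat_piece_0 by (intro exI[of _ "{A}"]) auto
  next
    case (Suc r)
    note V = Suc.prems(1) and A = Suc.prems(2,3)
    \<comment> \<open>The witness \<open>f\<close> is regular, and vanishes on \<open>A\<close>,
      only in a neighbourhood \<open>S\<close> of \<open>a\<close>. With continuity of its
      derivative, the same \<open>f\<close> serves all points of \<open>A\<close> near
      \<open>a\<close>; hence \<open>A1\<close> is closed in \<open>A\<close> and so
      compact.\<close>
    define reg where "reg = (\<lambda>a S f v. open S \<and> a \<in> S \<and> Cr (Suc r) S f \<and> (\<forall>x\<in>A \<inter> S. f x = 0) \<and> v \<in> V \<and>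
      frechet_derivative f (at a) v \<noteq> (0::real))"
    define A1 where "A1 = {a \<in> A. \<forall>S f v. \<not> reg a S f v}"
    have "A1 \<subseteq> A" by (auto simp: A1_def)
    have chart: "\<exists>U \<P>. open U \<and> a \<in> U \<and> A1 \<inter> U = {} \<and> countable \<P> \<and> (A - A1) \<inter> U \<subseteq> \<Union>\<P> \<and>
        (\<forall>P\<in>\<P>. flat_piece (Suc r) V A P)" if "a \<in> A - A1" for a
    proof -
      obtain S v0 and f :: "'a \<Rightarrow> real" where S: "open S" "a \<in> S" and f: "Cr (Suc r) S f" and f0: "\<forall>x\<in>A \<inter> S. f x = 0"
        and v0: "v0 \<in> V" "frechet_derivative f (at a) v0 \<noteq> 0"
        using \<open>a \<in> A - A1\<close> by (auto simp: A1_def reg_def simp del: Cr.simps)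
      have "linear (frechet_derivative f (at a))"
        using Cr_has_derivative[OF f S(2)] has_derivative_linear by blast
      then obtain v where v: "v \<in> V" "norm v = 1" "frechet_derivative f (at a) v \<noteq> 0"
        using linear_normalize V v0 by metis
      obtain U Q \<Psi> where U: "open U" "a \<in> U" "U \<subseteq> S" and Q: "open Q"
        and UQ: "\<And>x. x \<in> U \<Longrightarrow> straighten f v x \<in> Q \<and> \<Psi> (straighten f v x) = x"
        and QU: "\<And>z. z \<in> Q \<Longrightarrow> \<Psi> z \<in> U \<and> straighten f v (\<Psi> z) = z"
        and \<Psi>: "Cr (Suc r) Q \<Psi>"
        and nz: "\<And>x. x \<in> U \<Longrightarrow> frechet_derivative f (at x) v \<noteq> 0"
        using straighten_local_inverse[OF S(1) f S(2) v(2,3)] by blast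
      obtain \<rho> where \<rho>: "\<rho> > 0" "cball a \<rho> \<subseteq> U"
        using U open_contains_cball by blast
      \<comment> \<open>Since \<open>f\<close> vanishes on \<open>A\<close> near \<open>a\<close>,
        the straightened points have coordinate 0 along \<open>v\<close>, so they lie in the
        hyperplane section \<open>V'\<close>.\<close>
      define V' where "V' = V \<inter> {x. x \<bullet> v = 0}"
      define A' where "A' = straighten f v ` (A \<inter> cball a \<rho>)"
      have A2U: "A \<inter> cball a \<rho> \<subseteq> U" using \<rho> by auto
      have "continuous_on (A \<inter> cball a \<rho>) (straighten f v)"
        unfolding straighten_def[abs_def]
        by (intro continuous_intros continuous_on_subset[OF Cr_continuous_on[OF f]]) (use A2U U in auto)
      then have "compact A'"
        unfolding A'_def using A by (intro compact_continuous_image compact_Int_closed) auto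
      have "A' \<subseteq> V'"
        using A(2) A2U U(3) f0 straighten_mem_iff[OF V v(1)] straighten_inner[OF v(2)]
        by (auto simp: A'_def V'_def)
      have "A' \<subseteq> Q" using UQ A2U by (auto simp: A'_def)
      have \<Psi>A': "\<Psi> ` A' = A \<inter> cball a \<rho>"
        using UQ A2U by (force simp: A'_def image_image)
      obtain \<P> where \<P>: "countable \<P>" "A' \<subseteq> \<Union>\<P>" "\<And>P. P \<in> \<P> \<Longrightarrow> flat_piece (Suc r) V' A' P"
        using outer[of V' A' "Suc r"] dim_hyperplane_section[OF V v(1,2)]
          subspace_hyperplane_section[OF V, of v] \<open>compact A'\<close> \<open>A' \<subseteq> V'\<close>
        by (auto simp: V'_def)
      have "flat_piece (Suc r) V A (\<Psi> ` P)" if "P \<in> \<P>" for P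
      proof (rule flat_piece_transfer[OF Q \<Psi> _ _ \<open>compact A'\<close> \<open>A' \<subseteq> Q\<close> _ \<P>(3)[OF that]])
        show "\<Psi> z \<in> V" if "z \<in> V" "z \<in> Q" for z
          using QU[OF that(2)] straighten_mem_iff[OF V v(1), of f "\<Psi> z"] that by simp
      qed (auto simp: V'_def \<Psi>A')
      moreover have "(A - A1) \<inter> ball a \<rho> \<subseteq> \<Union>((`) \<Psi> ` \<P>)"
      proof
        fix x assume "x \<in> (A - A1) \<inter> ball a \<rho>"
        then have "x \<in> \<Psi> ` A'" using \<Psi>A' by auto
        then show "x \<in> \<Union>((`) \<Psi> ` \<P>)" using \<P>(2) by blast
      qed
      moreover have "A1 \<inter> ball a \<rho> = {}"
      proof -
        have "reg x S f v" if "x \<in> A" "x \<in> U" for x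
          unfolding reg_def using S(1) f f0 v(1) nz[OF that(2)] that U(3) by auto
        moreover have "ball a \<rho> \<subseteq> U" using \<rho>(2) ball_subset_cball by blast
        moreover have "\<not> reg x S f v" if "x \<in> A1" for x
          using that by (simp add: A1_def)
        moreover note \<open>A1 \<subseteq> A\<close>
        ultimately show ?thesis by blast
      qed
      ultimately show ?thesis
        using \<P>(1) \<rho>(1) by (intro exI[of _ "ball a \<rho>"] exI[of _ "(`) \<Psi> ` \<P>"]) auto
    qed
    have "\<exists>\<P>. countable \<P> \<and> A - A1 \<subseteq> \<Union>\<P> \<and> (\<forall>P\<in>\<P>. flat_piece (Suc r) V A P)"
    proof (rule countable_family_Lindelof)
      fix a assume "a \<in> A - A1"
      then obtain U \<P> where "open U" "a \<in> U" "countable \<P>" "(A - A1) \<inter> U \<subseteq> \<Union>\<P>"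
        "\<forall>P\<in>\<P>. flat_piece (Suc r) V A P"
        using chart[of a] by metis
      then show "\<exists>U \<P>. open U \<and> a \<in> U \<and> countable \<P> \<and> (A - A1) \<inter> U \<subseteq> \<Union>\<P> \<and>
          (\<forall>P\<in>\<P>. flat_piece (Suc r) V A P)"
        by (intro exI[of _ U] exI[of _ \<P>]) simp
    qed
    then obtain \<P>1 where \<P>1: "countable \<P>1" "A - A1 \<subseteq> \<Union>\<P>1" "\<And>P. P \<in> \<P>1 \<Longrightarrow> flat_piece (Suc r) V A P"
      by blast
    obtain U where U: "\<And>a. a \<in> A - A1 \<Longrightarrow> open (U a) \<and> a \<in> U a \<and> A1 \<inter> U a = {}"
      using chart by metis
    have "A1 = A - (\<Union>a\<in>A - A1. U a)"
      using U \<open>A1 \<subseteq> A\<close> by blast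
    moreover have "compact (A - (\<Union>a\<in>A - A1. U a))"
      using U A by (intro compact_diff open_UN) auto
    ultimately have "compact A1" by simp
    moreover have "A1 \<subseteq> V" using A \<open>A1 \<subseteq> A\<close> by blast
    ultimately obtain \<P>2 where \<P>2: "countable \<P>2" "A1 \<subseteq> \<Union>\<P>2" "\<And>P. P \<in> \<P>2 \<Longrightarrow> flat_piece r V A1 P"
      using Suc.IH[OF V, of A1] by metis
    have "flat_piece (Suc r) V A P" if P2: "P \<in> \<P>2" for P
    proof -
      obtain W E \<psi> \<psi>' L \<eta> where P: "P \<subseteq> A1" "P = \<psi> ` E" and C: "C1_param V W E \<psi> \<psi>' L \<eta>"
        and F: "flat_param r A1 W E \<psi>"
        using \<P>2(3)[OF P2] unfolding flat_piece_def by auto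
      \<comment> \<open>It matters that flatness of order \<open>r\<close> is relative to
        \<open>A1\<close>: the derivatives along \<open>V\<close> of a function vanishing on
        \<open>A\<close> are known to vanish only on \<open>A1\<close>.\<close>
      have "flat_param (Suc r) A W E \<psi>"
        unfolding flat_param_def
      proof (intro allI impI)
        fix S and f :: "'a \<Rightarrow> real" and \<epsilon> :: real
        assume f: "open S \<and> A \<subseteq> S \<and> Cr (Suc r) S f \<and> (\<forall>a\<in>A. f a = 0)" and "\<epsilon> > 0"
        have D0: "frechet_derivative f (at a) v = 0" if "a \<in> A1" "v \<in> V" for a v
        proof -
          have "\<not> reg a S f v" "a \<in> A" using that(1) by (auto simp: A1_def)
          then show ?thesis using f that(2) unfolding reg_def by blast
        qed
        have "\<psi> ` E \<subseteq> A1" "A1 \<subseteq> S" "open S" "Cr (Suc r) S f"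
          using P f \<open>A1 \<subseteq> A\<close> by auto
        from flat_param_integrate[OF C F V \<open>compact A1\<close> this(1,3,2,4) D0 \<open>\<epsilon> > 0\<close>]
        obtain \<delta> where "\<delta> > 0"
          and \<delta>: "\<forall>x\<in>E. \<forall>y\<in>W. dist x y < \<delta> \<longrightarrow> \<bar>f (\<psi> y) - f (\<psi> x)\<bar> \<le> \<epsilon> * dist x y ^ Suc r"
          by blast
        have "f (\<psi> x) = 0" if "x \<in> E" for x
          using f P \<open>A1 \<subseteq> A\<close> that by blast
        then show "\<exists>\<delta>>0. \<forall>x\<in>E. \<forall>y\<in>W. dist x y < \<delta> \<longrightarrow> \<bar>f (\<psi> y)\<bar> \<le> \<epsilon> * dist x y ^ Suc r"
          using \<delta> \<open>\<delta> > 0\<close> by (intro exI[of _ \<delta>]) auto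
      qed
      then show ?thesis
        unfolding flat_piece_def using P C \<open>A1 \<subseteq> A\<close> by blast
    qed
    then show ?case
      using \<P>1 \<P>2 by (intro exI[of _ "\<P>1 \<union> \<P>2"]) auto
  qed
qed

section \<open>The Morse--Sard theorem\<close>

lemma closed_negligible_iff: "closed S \<Longrightarrow> negligible S \<longleftrightarrow> emeasure lborel S = 0"
  by (auto simp: negligible_iff_null_sets null_sets_completion_iff null_sets_def)

text \<open>
  Fubini is applied twice: first to \<open>(t, w)\<close> with \<open>w\<close> replaced by \<open>t\<close> in coordinate \<open>j\<close>, which shows that
  almost every line in direction \<open>j\<close> meets \<open>Z\<close> in a null set, and then to \<open>(t, w)\<close> with \<open>w\<close>
  shifted by \<open>t\<close>. This way no splitting of \<open>real^'m\<close> as a product is needed.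
\<close>

lemma negligible_slices:
  fixes Z :: "(real^'m::finite) set"
  assumes Z: "closed Z" and slices: "\<And>t. negligible {w. w + (t - w $ j) *\<^sub>R axis j 1 \<in> Z}"
  shows "negligible Z"
proof -
  define X where "X = {(t, w). w + (t - w $ j) *\<^sub>R axis j 1 \<in> Z}"
  define Y where "Y = {(t, w). w + t *\<^sub>R axis j 1 \<in> Z}"
  have clX: "closed X"
  proof -
    have "X = (\<lambda>p. snd p + (fst p - snd p $ j) *\<^sub>R axis j 1) -` Z"
      by (auto simp: X_def)
    moreover have "continuous_on UNIV (\<lambda>p::real \<times> (real^'m). snd p + (fst p - snd p $ j) *\<^sub>R axis j 1)"
      by (intro continuous_intros)
    ultimately show ?thesis
      by (simp add: closed_vimage[OF Z])
  qed
  have clY: "closed Y"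
  proof -
    have "Y = (\<lambda>p. snd p + fst p *\<^sub>R axis j 1) -` Z"
      by (auto simp: Y_def)
    moreover have "continuous_on UNIV (\<lambda>p::real \<times> (real^'m). snd p + fst p *\<^sub>R axis j 1)"
      by (intro continuous_intros)
    ultimately show ?thesis
      by (simp add: closed_vimage[OF Z])
  qed
  have "sets (lborel \<Otimes>\<^sub>M (lborel :: (real^'m) measure)) = sets (borel :: (real \<times> (real^'m)) measure)"
    unfolding lborel_prod by (rule sets_lborel)
  then have sX: "X \<in> sets (lborel \<Otimes>\<^sub>M lborel)" and sY: "Y \<in> sets (lborel \<Otimes>\<^sub>M lborel)"
    using borel_closed[OF clX] borel_closed[OF clY] by auto
  have clX1: "closed (Pair t -` X)" and clX2: "closed ((\<lambda>t. (t, w)) -` X)"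
    and clY1: "closed (Pair t -` Y)" and clY2: "closed ((\<lambda>t. (t, w)) -` Y)" for t w
    using clX clY by (auto intro!: closed_vimage continuous_intros)
  have "emeasure lborel (Pair t -` X) = 0" for t
    using slices[of t] clX1[of t] closed_negligible_iff[of "Pair t -` X"] by (simp add: X_def vimage_def)
  then have "emeasure (lborel \<Otimes>\<^sub>M lborel) X = 0"
    by (simp add: lborel.emeasure_pair_measure_alt[OF sX])
  then have "(\<integral>\<^sup>+w. emeasure lborel ((\<lambda>t. (t, w)) -` X) \<partial>lborel) = 0"
    by (simp add: lborel_pair.emeasure_pair_measure_alt2[OF sX])
  then have "AE w in lborel. emeasure lborel ((\<lambda>t. (t, w)) -` X) = 0"
    using lborel_pair.measurable_emeasure_Pair2[OF sX]
    by (subst (asm) nn_integral_0_iff_AE) auto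
  then have "AE w in lborel. emeasure lborel ((\<lambda>t. (t, w)) -` Y) = 0"
  proof eventually_elim
    case (elim w)
    then have "negligible ((\<lambda>t. (t, w)) -` X)"
      using closed_negligible_iff[OF clX2] by blast
    \<comment> \<open>For fixed \<open>w\<close> the fibres of \<open>X\<close> and \<open>Y\<close>
      are translates of each other by \<open>w $ j\<close>.\<close>
    then have "negligible ((+) (- w $ j) ` ((\<lambda>t. (t, w)) -` X))"
      by (rule negligible_translation)
    moreover have "(\<lambda>t. (t, w)) -` Y \<subseteq> (+) (- w $ j) ` ((\<lambda>t. (t, w)) -` X)"
    proof
      fix t assume "t \<in> (\<lambda>t. (t, w)) -` Y"
      then have "t + w $ j \<in> (\<lambda>t. (t, w)) -` X"
        by (simp add: X_def Y_def)
      then show "t \<in> (+) (- w $ j) ` ((\<lambda>t. (t, w)) -` X)"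
        by (intro image_eqI[of _ _ "t + w $ j"]) auto
    qed
    ultimately show ?case
      using closed_negligible_iff[OF clY2] negligible_subset by blast
  qed
  then have "(\<integral>\<^sup>+w. emeasure lborel ((\<lambda>t. (t, w)) -` Y) \<partial>lborel) = 0"
    using lborel_pair.measurable_emeasure_Pair2[OF sY]
    by (subst nn_integral_0_iff_AE) auto
  then have "emeasure (lborel \<Otimes>\<^sub>M lborel) Y = 0"
    by (simp add: lborel_pair.emeasure_pair_measure_alt2[OF sY])
  then have "(\<integral>\<^sup>+t. emeasure lborel (Pair t -` Y) \<partial>(lborel :: real measure)) = 0"
    by (simp add: lborel.emeasure_pair_measure_alt[OF sY])
  then have "AE t in (lborel :: real measure). emeasure lborel (Pair t -` Y) = 0"
    using lborel.measurable_emeasure_Pair[OF sY]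
    by (subst (asm) nn_integral_0_iff_AE) auto
  \<comment> \<open>Each fibre of \<open>Y\<close> at fixed \<open>t\<close> is a translate of
    \<open>Z\<close>, so a single good \<open>t\<close> suffices.\<close>
  moreover have "\<not> (AE t in (lborel :: real measure). False)"
    by (simp add: AE_iff_measurable[OF _ refl])
  ultimately obtain t :: real where "emeasure lborel (Pair t -` Y) = 0"
    by (metis (mono_tags, lifting) eventually_mono)
  then have "negligible (Pair t -` Y)"
    using closed_negligible_iff[OF clY1] by blast
  then have "negligible ((+) (t *\<^sub>R axis j 1) ` (Pair t -` Y))"
    by (rule negligible_translation)
  moreover have "Z \<subseteq> (+) (t *\<^sub>R axis j 1) ` (Pair t -` Y)"
  proof
    fix z assume "z \<in> Z"
    then show "z \<in> (+) (t *\<^sub>R axis j 1) ` (Pair t -` Y)"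
      by (intro image_eqI[of _ _ "z - t *\<^sub>R axis j 1"]) (auto simp: Y_def)
  qed
  ultimately show ?thesis
    using negligible_subset by blast
qed

text \<open>Cells of a grid of side 1 / K in orthonormal coordinates of \<open>W\<close>, with
  \<open>K\<close> of order 1 / \<delta>. What matters is that \<open>C\<close> does not depend on
  \<delta>.\<close>

lemma bounded_subspace_covering:
  fixes E W :: "'a::euclidean_space set"
  assumes W: "subspace W" and E: "E \<subseteq> W" "bounded E"
  obtains C where "0 < C"
    "\<And>\<delta>. 0 < \<delta> \<Longrightarrow> \<delta> \<le> 1 \<Longrightarrow> \<exists>\<C>. finite \<C> \<and> E = \<Union>\<C> \<and> real (card \<C>) * \<delta> ^ dim W \<le> C \<and>
       (\<forall>c\<in>\<C>. \<forall>x\<in>c. \<forall>y\<in>c. dist x y < \<delta>)"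
proof -
  obtain B where B: "B \<subseteq> W" "pairwise orthogonal B" "\<And>b. b \<in> B \<Longrightarrow> norm b = 1" "independent B"
    "card B = dim W" "span B = W"
    using orthonormal_basis_subspace[OF W] by metis
  have finB: "finite B" using B(4) independent_imp_finite by blast
  define d where "d = dim W"
  obtain R0 where R0: "\<And>x. x \<in> E \<Longrightarrow> norm x \<le> R0"
    using E(2) bounded_iff by blast
  define R where "R = nat \<lceil>\<bar>R0\<bar>\<rceil> + 1"
  have R: "norm x \<le> real R" if "x \<in> E" for x
    using R0[OF that] unfolding R_def by linarith
  \<comment> \<open>From (2 K R + 1)^d \<le> (3 R K)^d cells and K \<delta> \<le> d + 2.\<close>
  define C where "C = (3 * real R * (real d + 2)) ^ d"
  show thesis
  proof (rule that[of C])
    have "R > 0" by (simp add: R_def)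
    then have "0 < real R" by simp
    then show "0 < C" by (simp add: C_def add_nonneg_pos)
    fix \<delta> :: real assume \<delta>: "0 < \<delta>" "\<delta> \<le> 1"
    \<comment> \<open>Points of a cell differ by at most d / K; the numerator d + 1 makes this
      strictly less than \<delta> and keeps \<open>K\<close> positive for d = 0.\<close>
    define K where "K = nat \<lceil>(real d + 1) / \<delta>\<rceil>"
    have K: "(real d + 1) / \<delta> \<le> real K" "real K \<le> (real d + 1) / \<delta> + 1"
      using \<delta> by (auto simp: K_def of_nat_ceiling)
    have "0 < real K"
      using K(1) \<delta> by (smt (verit) divide_pos_pos of_nat_0_le_iff)
    then have "K > 0" by simp
    have K2: "real K * \<delta> \<le> real d + 2"
    proof -
      have "real K * \<delta> \<le> ((real d + 1) / \<delta> + 1) * \<delta>"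
        using K(2) \<delta> by (intro mult_right_mono) auto
      also have "\<dots> = real d + 1 + \<delta>"
        using \<delta> by (simp add: field_simps)
      finally show ?thesis using \<delta> by linarith
    qed
    define cell where "cell = (\<lambda>\<kappa>. {x \<in> E. \<forall>b\<in>B. \<lfloor>real K * (x \<bullet> b)\<rfloor> = \<kappa> b})"
    define I where "I = (\<Pi>\<^sub>E b\<in>B. {- int (K * R)..int (K * R)})"
    have "finite I" unfolding I_def using finB by (intro finite_PiE) auto
    have "real (card I) = (2 * real (K * R) + 1) ^ d"
      using finB by (simp add: I_def card_PiE B(5) d_def)
    also have "\<dots> \<le> (3 * real R * real K) ^ d"
    proof (rule power_mono)
      have "1 \<le> real K * real R"
        using \<open>K > 0\<close> mult_mono[of 1 "real K" 1 "real R"] by (simp add: R_def)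
      then show "2 * real (K * R) + 1 \<le> 3 * real R * real K"
        by (simp add: mult_ac)
    qed simp
    finally have cI: "real (card I) \<le> (3 * real R * real K) ^ d" .
    have "real (card (cell ` I)) * \<delta> ^ dim W \<le> (3 * real R * real K) ^ d * \<delta> ^ d"
      unfolding d_def[symmetric] using cI card_image_le[OF \<open>finite I\<close>, of cell] \<delta>
      by (intro mult_right_mono) auto
    also have "\<dots> = (3 * real R * (real K * \<delta>)) ^ d"
      by (simp add: power_mult_distrib)
    also have "\<dots> \<le> C"
      unfolding C_def using K2 \<delta> by (intro power_mono mult_left_mono) auto
    finally have 1: "real (card (cell ` I)) * \<delta> ^ dim W \<le> C" .
    have 2: "E = \<Union>(cell ` I)"
    proof (intro subset_antisym subsetI)
      fix x assume x: "x \<in> E"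
      have "\<lfloor>real K * (x \<bullet> b)\<rfloor> \<in> {- int (K * R)..int (K * R)}" if "b \<in> B" for b
      proof -
        have "\<bar>x \<bullet> b\<bar> \<le> real R"
          using Cauchy_Schwarz_ineq2[of x b] B(3)[OF that] R[OF x] by simp
        then have "\<bar>real K * (x \<bullet> b)\<bar> \<le> real (K * R)"
          by (simp add: abs_mult mult_left_mono)
        then have "real_of_int (- int (K * R)) \<le> real K * (x \<bullet> b)" "real K * (x \<bullet> b) \<le> real_of_int (int (K * R))"
          by (auto simp: abs_le_iff)
        then show ?thesis
          by (auto simp: le_floor_iff floor_le_iff)
      qed
      then have "restrict (\<lambda>b. \<lfloor>real K * (x \<bullet> b)\<rfloor>) B \<in> I"
        by (auto simp: I_def)
      moreover have "x \<in> cell (restrict (\<lambda>b. \<lfloor>real K * (x \<bullet> b)\<rfloor>) B)"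
        using x by (simp add: cell_def)
      ultimately show "x \<in> \<Union>(cell ` I)" by blast
    qed (auto simp: cell_def)
    have 3: "dist x y < \<delta>" if "x \<in> cell \<kappa>" "y \<in> cell \<kappa>" for x y \<kappa>
    proof -
      have "x - y \<in> span B"
        using that E W B(6) by (auto simp: cell_def intro: subspace_diff)
      then have "x - y = (\<Sum>b\<in>B. ((x - y) \<bullet> b) *\<^sub>R b)"
        using orthonormal_basis_expand[OF B(2,3) _ finB] by simp
      then have "norm (x - y) \<le> (\<Sum>b\<in>B. norm (((x - y) \<bullet> b) *\<^sub>R b))"
        using norm_sum by metis
      also have "\<dots> \<le> (\<Sum>b\<in>B. 1 / real K)"
      proof (rule sum_mono)
        fix b assume b: "b \<in> B"
        have "\<lfloor>real K * (x \<bullet> b)\<rfloor> = \<lfloor>real K * (y \<bullet> b)\<rfloor>"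
          using that b by (simp add: cell_def)
        then have "\<bar>real K * (x \<bullet> b) - real K * (y \<bullet> b)\<bar> \<le> 1"
          by linarith
        then have "real K * \<bar>(x - y) \<bullet> b\<bar> \<le> 1"
          by (simp add: inner_diff_left abs_mult flip: right_diff_distrib)
        then show "norm (((x - y) \<bullet> b) *\<^sub>R b) \<le> 1 / real K"
          using B(3)[OF b] \<open>0 < real K\<close> by (simp add: field_simps)
      qed
      also have "\<dots> = real d / real K"
        by (simp add: B(5) d_def)
      also have "\<dots> < \<delta>"
      proof -
        have "real d + 1 \<le> real K * \<delta>"
          using K(1) \<delta> by (simp add: field_simps)
        then show ?thesis
          using \<open>0 < real K\<close> by (simp add: field_simps)
      qed
      finally show ?thesis by (simp add: dist_norm)
    qed
    show "\<exists>\<C>. finite \<C> \<and> E = \<Union>\<C> \<and> real (card \<C>) * \<delta> ^ dim W \<le> C \<and>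
       (\<forall>c\<in>\<C>. \<forall>x\<in>c. \<forall>y\<in>c. dist x y < \<delta>)"
      using \<open>finite I\<close> 1 2 3 by (intro exI[of _ "cell ` I"]) auto
  qed
qed

text \<open>The coordinates outside \<open>J\<close> are free; for \<open>J = UNIV\<close> this is
  the image of \<open>A\<close> under \<open>F\<close>.\<close>

definition cylinder :: "'m set \<Rightarrow> ('m \<Rightarrow> 'a \<Rightarrow> real) \<Rightarrow> 'a set \<Rightarrow> (real^'m::finite) set" where
  "cylinder J F A = {w. \<exists>a\<in>A. \<forall>j\<in>J. w $ j = F j a}"

text \<open>The cylinder is the sum of a compact set, the image filled up with zeros outside
  \<open>J\<close>, and the closed subspace of vectors vanishing on \<open>J\<close>. Closedness is
  what \<open>negligible_slices\<close> asks for.\<close>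

lemma closed_cylinder:
  fixes F :: "'m::finite \<Rightarrow> 'a::euclidean_space \<Rightarrow> real"
  assumes A: "compact A" and F: "\<And>j. j \<in> J \<Longrightarrow> continuous_on A (F j)"
  shows "closed (cylinder J F A)"
proof -
  define g where "g = (\<lambda>a. \<chi> j. if j \<in> J then F j a else 0)"
  have "continuous_on A g"
    unfolding g_def
  proof (intro continuous_on_vec_lambda)
    show "continuous_on A (\<lambda>x. if j \<in> J then F j x else 0)" for j
      by (cases "j \<in> J") (auto intro: F)
  qed
  then have "compact (g ` A)"
    using A by (rule compact_continuous_image)
  moreover have "closed {v :: real^'m. \<forall>j\<in>J. v $ j = 0}"
  proof -
    have "{v :: real^'m. \<forall>j\<in>J. v $ j = 0} = (\<Inter>j\<in>J. {v. v $ j = 0})" by auto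
    moreover have "closed {v :: real^'m. v $ j = 0}" for j
      by (intro closed_Collect_eq continuous_intros)
    ultimately show ?thesis by (simp add: closed_INT)
  qed
  ultimately have "closed (\<Union>x\<in>g ` A. \<Union>y\<in>{v. \<forall>j\<in>J. v $ j = 0}. {x + y})"
    by (rule compact_closed_sums)
  moreover have "cylinder J F A = (\<Union>x\<in>g ` A. \<Union>y\<in>{v. \<forall>j\<in>J. v $ j = 0}. {x + y})"
  proof (intro subset_antisym subsetI)
    fix w assume "w \<in> cylinder J F A"
    then obtain a where a: "a \<in> A" "\<forall>j\<in>J. w $ j = F j a" by (auto simp: cylinder_def)
    then have "w = g a + (w - g a)" "\<forall>j\<in>J. (w - g a) $ j = 0" by (auto simp: g_def)
    with a(1) show "w \<in> (\<Union>x\<in>g ` A. \<Union>y\<in>{v. \<forall>j\<in>J. v $ j = 0}. {x + y})" by blast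
  qed (auto simp: cylinder_def g_def)
  ultimately show ?thesis by simp
qed

section \<open>Volume estimates for cylinders\<close>

lemma negligible_UN_countable:
  "countable \<P> \<Longrightarrow> (\<And>P. P \<in> \<P> \<Longrightarrow> negligible (f P)) \<Longrightarrow> negligible (\<Union>P\<in>\<P>. f P)"
  unfolding negligible_iff_null_sets by (rule null_sets_UN')

lemma cylinder_box:
  fixes y :: "'m::finite \<Rightarrow> real" and J :: "'m set" and n :: nat and \<rho> :: real
  assumes "0 \<le> \<rho>"
  defines "lo \<equiv> (\<chi> j. if j \<in> J then y j - \<rho> else - real n) :: real^'m"
    and "hi \<equiv> (\<chi> j. if j \<in> J then y j + \<rho> else real n)"
  shows "measure lebesgue (cbox lo hi) = (2 * \<rho>) ^ card J * (2 * real n) ^ card (- J)"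
proof -
  have "lo \<in> cbox lo hi"
    using assms by (auto simp: mem_box_cart)
  then have "measure lebesgue (cbox lo hi) = (\<Prod>j\<in>UNIV. hi $ j - lo $ j)"
    using content_cbox_cart[of lo hi] by auto
  also have "\<dots> = (\<Prod>j\<in>UNIV. if j \<in> J then 2 * \<rho> else 2 * real n)"
    by (rule prod.cong) (auto simp: lo_def hi_def)
  also have "\<dots> = (2 * \<rho>) ^ card J * (2 * real n) ^ card (- J)"
    by (subst prod.If_cases) (auto simp: Compl_eq)
  finally show ?thesis .
qed

text \<open>A cell of diameter below \<delta> has its image in a box of side 2 \<epsilon> \<delta>^r
  in each of the \<open>card J\<close> directions, and there are at most K \<delta>^(-dim W) cells.
  As dim W \<le> r * card J, the powers of \<delta> cancel or help, and a multiple of (2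
  \<epsilon>)^(card J) remains.\<close>

lemma negligible_cylinder_flat:
  fixes F :: "'m::finite \<Rightarrow> 'a::euclidean_space \<Rightarrow> real"
  assumes V: "subspace V" and A: "compact A" "A \<subseteq> V" "A \<subseteq> S" and S: "open S"
    and F: "\<And>j. j \<in> J \<Longrightarrow> Cr r S (F j)" and r: "1 \<le> r" "dim V \<le> r * card J" and J: "J \<noteq> {}"
    and D0: "\<And>a j v. a \<in> A \<Longrightarrow> j \<in> J \<Longrightarrow> v \<in> V \<Longrightarrow> frechet_derivative (F j) (at a) v = 0"
  shows "negligible (cylinder J F A)"
proof -
  obtain q where q: "r = Suc q" using r(1) by (cases r) auto
  \<comment> \<open>The order is q = r - 1, since flatness is applied to the derivatives of the
    \<open>F j\<close>, which are of class C^q; integration restores order \<open>r\<close>.\<close>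
  obtain \<P> where \<P>: "countable \<P>" "A \<subseteq> \<Union>\<P>" "\<And>P. P \<in> \<P> \<Longrightarrow> flat_piece q V A P"
    using flat_decomposition[OF V A(1,2), of q] by blast
  have "negligible (cylinder J F P)" if PP: "P \<in> \<P>" for P
  proof -
    obtain W E \<psi> \<psi>' L \<eta> where P: "P \<subseteq> A" "P = \<psi> ` E" and C: "C1_param V W E \<psi> \<psi>' L \<eta>"
      and flat: "flat_param q A W E \<psi>"
      using \<P>(3)[OF PP] unfolding flat_piece_def by auto
    have W: "subspace W" "E \<subseteq> W" "bounded E" and dimW: "dim W \<le> r * card J"
      using C r(2) by (auto simp: C1_param_def)
    obtain K where "0 < K" and K: "\<And>\<delta>. 0 < \<delta> \<Longrightarrow> \<delta> \<le> 1 \<Longrightarrow> \<exists>\<C>. finite \<C> \<and> E = \<Union>\<C> \<and>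
        real (card \<C>) * \<delta> ^ dim W \<le> K \<and> (\<forall>c\<in>\<C>. \<forall>x\<in>c. \<forall>y\<in>c. dist x y < \<delta>)"
      using bounded_subspace_covering[OF W] by blast
    \<comment> \<open>The cylinder is unbounded in the coordinates outside \<open>J\<close>; cutting
      it by a cube of side 2 n makes the volumes finite.\<close>
    have "negligible (cylinder J F P \<inter> cbox (\<chi> j. - real n) (\<chi> j. real n))" for n
      unfolding negligible_outer
    proof (intro allI impI)
      fix e :: real assume "e > 0"
      define N where "N = (2 * real n) ^ card (- J)"
      have "N \<ge> 0" by (simp add: N_def)
      \<comment> \<open>The bound 1/2 gives (2 \<epsilon>)^(card J) \<le> 2 \<epsilon>; the other
        one gives K (2 \<epsilon>) N \<le> e / 2, where the 1 covers N = 0.\<close>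
      define \<epsilon> where "\<epsilon> = min (1/2) (e / (4 * (K * N + 1)))"
      have KN: "0 < K * N + 1" using \<open>0 < K\<close> \<open>0 \<le> N\<close> by (simp add: add_nonneg_pos)
      have \<epsilon>: "0 < \<epsilon>" "2 * \<epsilon> \<le> 1" "\<epsilon> * (4 * (K * N + 1)) \<le> e"
      proof -
        show "0 < \<epsilon>" "2 * \<epsilon> \<le> 1" using KN \<open>e > 0\<close> by (auto simp: \<epsilon>_def)
        have "\<epsilon> \<le> e / (4 * (K * N + 1))" by (simp add: \<epsilon>_def)
        then show "\<epsilon> * (4 * (K * N + 1)) \<le> e"
          using KN by (simp add: pos_le_divide_eq)
      qed
      have "\<exists>\<delta>>0. \<forall>j\<in>J. \<forall>x\<in>E. \<forall>y\<in>W. dist x y < \<delta> \<longrightarrow> \<bar>F j (\<psi> y) - F j (\<psi> x)\<bar> \<le> \<epsilon> * dist x y ^ r"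
      proof (rule finite_ex_pos_uniform)
        fix j assume j: "j \<in> J"
        have "\<psi> ` E \<subseteq> A" "Cr (Suc q) S (F j)" using P F[OF j] q by auto
        from flat_param_integrate[OF C flat V A(1) this(1) S A(3) this(2) D0[OF _ j] \<epsilon>(1)]
        show "\<exists>\<delta>>0. \<forall>x\<in>E. \<forall>y\<in>W. dist x y < \<delta> \<longrightarrow> \<bar>F j (\<psi> y) - F j (\<psi> x)\<bar> \<le> \<epsilon> * dist x y ^ r"
          unfolding q .
      qed auto
      then obtain \<delta>0 where "\<delta>0 > 0"
        and \<delta>0: "\<And>j x y. j \<in> J \<Longrightarrow> x \<in> E \<Longrightarrow> y \<in> W \<Longrightarrow> dist x y < \<delta>0 \<Longrightarrow> \<bar>F j (\<psi> y) - F j (\<psi> x)\<bar> \<le> \<epsilon> * dist x y ^ r"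
        by metis
      define \<delta> where "\<delta> = min 1 \<delta>0"
      have \<delta>: "0 < \<delta>" "\<delta> \<le> 1" using \<open>\<delta>0 > 0\<close> by (auto simp: \<delta>_def)
      obtain \<C> where \<C>: "finite \<C>" "E = \<Union>\<C>" "real (card \<C>) * \<delta> ^ dim W \<le> K"
        and diam: "\<And>c x y. c \<in> \<C> \<Longrightarrow> x \<in> c \<Longrightarrow> y \<in> c \<Longrightarrow> dist x y < \<delta>"
        using K[OF \<delta>] by metis
      \<comment> \<open>For an empty cell the choice is arbitrary; its box has the same volume, so
        the count is unaffected.\<close>
      define p where "p = (\<lambda>c::'a set. SOME x. x \<in> c)"
      define bx where "bx = (\<lambda>c. cbox (\<chi> j. if j \<in> J then F j (\<psi> (p c)) - \<epsilon> * \<delta> ^ r else - real n)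
        (\<chi> j. if j \<in> J then F j (\<psi> (p c)) + \<epsilon> * \<delta> ^ r else real n))"
      have mbx: "measure lebesgue (bx c) = (2 * (\<epsilon> * \<delta> ^ r)) ^ card J * N" for c
        unfolding bx_def N_def using \<epsilon>(1) \<delta>(1) by (intro cylinder_box) simp
      have cover: "cylinder J F P \<inter> cbox (\<chi> j. - real n) (\<chi> j. real n) \<subseteq> (\<Union>c\<in>\<C>. bx c)"
      proof
        fix w assume w: "w \<in> cylinder J F P \<inter> cbox (\<chi> j. - real n) (\<chi> j. real n)"
        then obtain x where x: "x \<in> E" "\<And>j. j \<in> J \<Longrightarrow> w $ j = F j (\<psi> x)"
          by (auto simp: cylinder_def P)
        then obtain c where c: "c \<in> \<C>" "x \<in> c" using \<C>(2) by auto
        then have pc: "p c \<in> c" unfolding p_def by (auto intro: someI)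
        have pE: "p c \<in> E" using c pc \<C>(2) by blast
        have d: "dist (p c) x < \<delta>" using diam c pc by blast
        have "\<bar>F j (\<psi> x) - F j (\<psi> (p c))\<bar> \<le> \<epsilon> * \<delta> ^ r" if "j \<in> J" for j
        proof -
          have "\<bar>F j (\<psi> x) - F j (\<psi> (p c))\<bar> \<le> \<epsilon> * dist (p c) x ^ r"
            using x(1) W(2) d by (intro \<delta>0 that pE) (auto simp: \<delta>_def)
          also have "\<dots> \<le> \<epsilon> * \<delta> ^ r"
            using d \<epsilon>(1) by (intro mult_left_mono power_mono) auto
          finally show ?thesis .
        qed
        then have "w \<in> bx c"
          using w x(2) by (auto simp: bx_def mem_box_cart abs_le_iff algebra_simps)
        then show "w \<in> (\<Union>c\<in>\<C>. bx c)" using c by blast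
      qed
      have "measure lebesgue (\<Union>c\<in>\<C>. bx c) \<le> (\<Sum>c\<in>\<C>. measure lebesgue (bx c))"
        by (rule measure_UNION_le[OF \<C>(1)]) (simp add: bx_def)
      also have "\<dots> = real (card \<C>) * \<delta> ^ (r * card J) * ((2 * \<epsilon>) ^ card J * N)"
        by (simp add: mbx power_mult_distrib power_mult mult_ac)
      also have "\<dots> \<le> K * ((2 * \<epsilon>) * N)"
      proof (intro mult_mono mult_right_mono)
        have "real (card \<C>) * \<delta> ^ (r * card J) \<le> real (card \<C>) * \<delta> ^ dim W"
          using \<delta> dimW by (intro mult_left_mono power_decreasing) auto
        then show "real (card \<C>) * \<delta> ^ (r * card J) \<le> K" using \<C>(3) by linarith
        have "card J \<ge> 1" using J by (simp add: Suc_le_eq card_gt_0_iff)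
        then show "(2 * \<epsilon>) ^ card J \<le> 2 * \<epsilon>"
          using \<epsilon>(1,2) power_decreasing[of 1 "card J" "2 * \<epsilon>"] by simp
      qed (use \<open>0 < K\<close> \<open>0 \<le> N\<close> \<epsilon>(1) in auto)
      also have "\<dots> < e"
        using \<epsilon>(1,3) \<open>0 < K\<close> \<open>0 \<le> N\<close> \<open>e > 0\<close> by (simp add: algebra_simps)
      finally have "measure lebesgue (\<Union>c\<in>\<C>. bx c) < e" .
      moreover have "(\<Union>c\<in>\<C>. bx c) \<in> lmeasurable"
        using \<C>(1) by (intro fmeasurable.finite_UN) (auto simp: bx_def)
      ultimately show "\<exists>T. cylinder J F P \<inter> cbox (\<chi> j. - real n) (\<chi> j. real n) \<subseteq> T \<and> T \<in> lmeasurable \<and>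
          measure lebesgue T < e"
        using cover by blast
    qed
    then have "negligible (\<Union>n\<in>UNIV. cylinder J F P \<inter> cbox (\<chi> j. - real n) (\<chi> j. real n))"
      by (intro negligible_UN_countable) auto
    moreover have "cylinder J F P \<subseteq> (\<Union>n\<in>UNIV. cylinder J F P \<inter> cbox (\<chi> j. - real n) (\<chi> j. real n))"
    proof
      fix w assume "w \<in> cylinder J F P"
      obtain n where "norm w \<le> real n" using real_arch_simple by blast
      then have "\<bar>w $ i\<bar> \<le> real n" for i
        using component_le_norm_cart[of w i] by linarith
      then have "w \<in> cbox (\<chi> j. - real n) (\<chi> j. real n)"
        by (simp add: mem_box_cart abs_le_iff minus_le_iff)
      then show "w \<in> (\<Union>n\<in>UNIV. cylinder J F P \<inter> cbox (\<chi> j. - real n) (\<chi> j. real n))"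
        using \<open>w \<in> cylinder J F P\<close> by blast
    qed
    ultimately show ?thesis using negligible_subset by blast
  qed
  then have "negligible (\<Union>P\<in>\<P>. cylinder J F P)"
    using \<P>(1) by (intro negligible_UN_countable)
  moreover have "cylinder J F A \<subseteq> (\<Union>P\<in>\<P>. cylinder J F P)"
    using \<P>(2) by (fastforce simp: cylinder_def)
  ultimately show ?thesis using negligible_subset by blast
qed

lemma slice_rank_drop:
  fixes F :: "'m::finite \<Rightarrow> 'a::euclidean_space \<Rightarrow> real"
  assumes V: "subspace V" and J: "finite J" "j \<in> J" and v: "v \<in> V"
    and Q: "open Q" "p \<in> Q" "p \<in> V" and \<Psi>: "(\<Psi> has_derivative \<Psi>') (at p)"
    and \<Psi>V: "\<And>z. z \<in> V \<Longrightarrow> z \<in> Q \<Longrightarrow> \<Psi> z \<in> V"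
    and F: "\<And>i. i \<in> J \<Longrightarrow> (F i has_derivative F' i) (at (\<Psi> p))"
    and Fj: "\<And>z. z \<in> Q \<Longrightarrow> F j (\<Psi> z) = z \<bullet> v" and nz: "F' j v \<noteq> 0"
    and c: "\<exists>j\<in>J. c j \<noteq> 0" "\<And>h. h \<in> V \<Longrightarrow> (\<Sum>i\<in>J. c i * F' i h) = 0"
  shows "(\<exists>i\<in>J - {j}. c i \<noteq> 0) \<and>
    (\<forall>h\<in>V \<inter> {x. x \<bullet> v = 0}. (\<Sum>i\<in>J - {j}. c i * F' i (\<Psi>' h)) = 0)"
proof (intro conjI ballI)
  show "\<exists>i\<in>J - {j}. c i \<noteq> 0"
  proof (rule ccontr)
    assume "\<not> (\<exists>i\<in>J - {j}. c i \<noteq> 0)"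
    then have "c i * F' i v = 0" if "i \<in> J - {j}" for i using that by simp
    then have "(\<Sum>i\<in>J. c i * F' i v) = c j * F' j v" and "c j \<noteq> 0"
      using c(1) J \<open>\<not> (\<exists>i\<in>J - {j}. c i \<noteq> 0)\<close> by (auto simp: sum.remove[OF J])
    then show False using c(2)[OF v] nz by simp
  qed
next
  fix h assume h: "h \<in> V \<inter> {x. x \<bullet> v = 0}"
  obtain e where e: "e > 0" "ball p e \<subseteq> Q"
    using Q(1,2) open_contains_ball by blast
  have "\<Psi>' h \<in> V"
  proof (rule derivative_in_subspace[where \<psi> = \<Psi> and D = \<Psi>' and z = p and k = h and e = "e / (norm h + 1)", OF V \<Psi>])
    show "0 < e / (norm h + 1)" using e(1) by (simp add: add_nonneg_pos)
    show "\<Psi> (p + t *\<^sub>R h) \<in> V" if t: "\<bar>t\<bar> < e / (norm h + 1)" for t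
    proof (rule \<Psi>V)
      show "p + t *\<^sub>R h \<in> V"
        using V Q(3) h by (auto intro: subspace_add subspace_mul)
      have "0 < norm h + 1" by (simp add: add_nonneg_pos)
      then have "\<bar>t\<bar> * (norm h + 1) < e"
        using t by (simp add: pos_less_divide_eq)
      moreover have "\<bar>t\<bar> * norm h \<le> \<bar>t\<bar> * (norm h + 1)"
        by (intro mult_left_mono) auto
      ultimately have "dist p (p + t *\<^sub>R h) < e"
        by (simp add: dist_norm)
      then show "p + t *\<^sub>R h \<in> Q" using e(2) by auto
    qed
  qed
  moreover have "F' j (\<Psi>' h) = 0"
  proof -
    have "((\<lambda>z. F j (\<Psi> z)) has_derivative (\<lambda>h. F' j (\<Psi>' h))) (at p)"
      by (rule has_derivative_compose[OF \<Psi> F[OF J(2)]])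
    then have 1: "((\<lambda>z. z \<bullet> v) has_derivative (\<lambda>h. F' j (\<Psi>' h))) (at p)"
      by (rule has_derivative_transform_within_open[OF _ Q(1,2) Fj])
    have "((\<lambda>z. z \<bullet> v) has_derivative (\<lambda>h. h \<bullet> v)) (at p)"
      by (intro bounded_linear_imp_has_derivative bounded_linear_inner_left)
    then have "(\<lambda>h. F' j (\<Psi>' h)) = (\<lambda>h. h \<bullet> v)"
      using 1 has_derivative_unique by blast
    then show ?thesis using h by (metis Int_iff mem_Collect_eq)
  qed
  ultimately show "(\<Sum>i\<in>J - {j}. c i * F' i (\<Psi>' h)) = 0"
    using c(2)[of "\<Psi>' h"] by (simp add: sum.remove[OF J])
qed

text \<open>
  That the derivative along \<open>V\<close> has rank less than \<open>card J\<close> is expressed by a linear dependence of its rows.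
  The image is replaced by its cylinder, so that all sets stay in \<open>real^'m\<close> when \<open>J\<close> shrinks.
\<close>

theorem Morse_Sard:
  fixes F :: "'m::finite \<Rightarrow> 'a::euclidean_space \<Rightarrow> real"
  assumes "subspace V" "open S" "compact A" "A \<subseteq> V" "A \<subseteq> S"
    and "\<And>j. j \<in> J \<Longrightarrow> Cr r S (F j)" "1 \<le> r" "dim V + 1 \<le> r + card J" "J \<noteq> {}"
    and "\<And>a. a \<in> A \<Longrightarrow>
      \<exists>c. (\<exists>j\<in>J. c j \<noteq> 0) \<and> (\<forall>v\<in>V. (\<Sum>j\<in>J. c j * frechet_derivative (F j) (at a) v) = 0)"
  shows "negligible (cylinder J F A)"
  using assms
proof (induction "card J" arbitrary: J V S A F rule: less_induct)
  case less
  note V = less.prems(1) and S = less.prems(2) and A = less.prems(3-5) and F = less.prems(6)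
    and r = less.prems(7,8) and J = less.prems(9) and rank = less.prems(10)
  obtain r' where r': "r = Suc r'" using r(1) by (cases r) auto
  have FS: "Cr (Suc r') S (F j)" if "j \<in> J" for j using F[OF that] r' by simp
  have contF: "continuous_on A (F j)" if "j \<in> J" for j
    using Cr_continuous_on[OF F[OF that]] continuous_on_subset A(3) by blast
  define A0 where "A0 = {a \<in> A. \<forall>j\<in>J. \<forall>v\<in>V. frechet_derivative (F j) (at a) v = 0}"
  have chart: "\<exists>U. open U \<and> a \<in> U \<and> A0 \<inter> U = {} \<and> negligible (cylinder J F (A \<inter> U))"
    if aA: "a \<in> A - A0" for a
  proof -
    obtain j v0 where j: "j \<in> J" and v0: "v0 \<in> V" "frechet_derivative (F j) (at a) v0 \<noteq> 0"
      using aA by (auto simp: A0_def)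
    have aS: "a \<in> S" using aA A by auto
    have "linear (frechet_derivative (F j) (at a))"
      using Cr_has_derivative[OF FS[OF j] aS] has_derivative_linear by blast
    then obtain v where v: "v \<in> V" "norm v = 1" "frechet_derivative (F j) (at a) v \<noteq> 0"
      using linear_normalize V v0 by metis
    obtain U Q \<Psi> where U: "open U" "a \<in> U" "U \<subseteq> S" and Q: "open Q"
      and UQ: "\<And>x. x \<in> U \<Longrightarrow> straighten (F j) v x \<in> Q \<and> \<Psi> (straighten (F j) v x) = x"
      and QU: "\<And>z. z \<in> Q \<Longrightarrow> \<Psi> z \<in> U \<and> straighten (F j) v (\<Psi> z) = z"
      and \<Psi>: "Cr (Suc r') Q \<Psi>"
      and nz: "\<And>x. x \<in> U \<Longrightarrow> frechet_derivative (F j) (at x) v \<noteq> 0"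
      using straighten_local_inverse[OF S FS[OF j] aS v(2,3)] by blast
    obtain \<rho> where \<rho>: "\<rho> > 0" "cball a \<rho> \<subseteq> U"
      using U open_contains_cball by blast
    define A2 where "A2 = A \<inter> cball a \<rho>"
    have A2: "A2 \<subseteq> U" "A2 \<subseteq> A" "compact A2" "a \<in> A2"
      using \<rho> A aA by (auto simp: A2_def intro: compact_Int_closed)
    define V' where "V' = V \<inter> {x. x \<bullet> v = 0}"
    have \<Psi>V: "\<Psi> z \<in> V" if "z \<in> V" "z \<in> Q" for z
      using QU[OF that(2)] straighten_mem_iff[OF V v(1), of "F j" "\<Psi> z"] that by simp
    have Fj\<Psi>: "F j (\<Psi> z) = z \<bullet> v" if "z \<in> Q" for z
      using QU[OF that] straighten_inner[OF v(2), of "F j" "\<Psi> z"] by simp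
    have contA2: "continuous_on A2 (F i)" if "i \<in> J" for i
      using contF[OF that] A2 continuous_on_subset by blast
    have rankx: "\<exists>c. (\<exists>j\<in>J. c j \<noteq> 0) \<and> (\<forall>h\<in>V. (\<Sum>i\<in>J. c i * frechet_derivative (F i) (at x) h) = 0)"
      if "x \<in> A2" for x
      using rank that A2(2) by blast
    \<comment> \<open>If only \<open>j\<close> were present, the dependence would force the
      derivative of \<open>F j\<close> along \<open>V\<close> to vanish at \<open>a\<close>,
      contrary to the choice of \<open>v\<close>.\<close>
    have Jj: "J - {j} \<noteq> {}"
    proof
      assume "J - {j} = {}"
      then have "J = {j}" using j by auto
      then show False using rankx[OF A2(4)] nz[OF U(2)] v(1) by auto
    qed
    have "negligible (cylinder J F A2)"
    proof (rule negligible_slices[where j = j])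
      show "closed (cylinder J F A2)"
        using A2 contA2 by (intro closed_cylinder)
      fix t :: real
      \<comment> \<open>In the chart the level set F j = t lies in the affine hyperplane z \<bullet>
        v = t. Subtracting t v moves it into the linear subspace \<open>V'\<close>, to which the
        induction hypothesis applies.\<close>
      define At where "At = (\<lambda>x. straighten (F j) v x - t *\<^sub>R v) ` (A2 \<inter> F j -` {t})"
      define G where "G = (\<lambda>i z. F i (\<Psi> (z + t *\<^sub>R v)))"
      define St where "St = (\<lambda>z. z + t *\<^sub>R v) -` Q"
      have "open St"
        unfolding St_def by (intro open_vimage Q continuous_intros)
      have "compact (A2 \<inter> F j -` {t})"
      proof -
        have "closed (A2 \<inter> F j -` {t})"
          using contA2[OF j] A2(3) by (intro continuous_closed_preimage) (auto simp: compact_imp_closed)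
        then show ?thesis
          using compact_Int_closed[OF A2(3)] by (metis Int_assoc Int_absorb)
      qed
      moreover have "continuous_on (A2 \<inter> F j -` {t}) (\<lambda>x. straighten (F j) v x - t *\<^sub>R v)"
        unfolding straighten_def[abs_def]
        by (intro continuous_intros continuous_on_subset[OF contA2[OF j]]) auto
      ultimately have "compact At"
        unfolding At_def by (rule compact_continuous_image[rotated])
      have "At \<subseteq> V'"
      proof
        fix z assume "z \<in> At"
        then obtain x where x: "x \<in> A2" "F j x = t" "z = straighten (F j) v x - t *\<^sub>R v" by (auto simp: At_def)
        have "straighten (F j) v x \<in> V"
          using straighten_mem_iff[OF V v(1)] x(1) A2(2) A(2) by blast
        then show "z \<in> V'"
          using V v straighten_inner[OF v(2), of "F j" x] x(2)
          by (auto simp: V'_def x(3) inner_diff_left dot_square_norm subspace_diff subspace_mul)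
      qed
      have AtS: "At \<subseteq> St" using UQ A2(1) by (auto simp: At_def St_def)
      have "Cr r St (G i)" if "i \<in> J" for i
        unfolding G_def
      proof (rule Cr_compose[where f = "F i" and g = "\<lambda>z. \<Psi> (z + t *\<^sub>R v)", OF \<open>open St\<close> S F[OF that]])
        have "Cr r St (\<lambda>z. z + t *\<^sub>R v)"
          using \<open>open St\<close> by (intro Cr_add Cr_const Cr_bounded_linear bounded_linear_ident)
        then show "Cr r St (\<lambda>z. \<Psi> (z + t *\<^sub>R v))"
          using \<Psi> by (intro Cr_compose[where f = \<Psi> and g = "\<lambda>z. z + t *\<^sub>R v", OF \<open>open St\<close> Q]) (auto simp: St_def r')
        show "(\<lambda>z. \<Psi> (z + t *\<^sub>R v)) ` St \<subseteq> S"
          using QU U(3) by (auto simp: St_def)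
      qed
      moreover have "\<exists>c. (\<exists>i\<in>J - {j}. c i \<noteq> 0) \<and>
          (\<forall>h\<in>V'. (\<Sum>i\<in>J - {j}. c i * frechet_derivative (G i) (at z) h) = 0)" if "z \<in> At" for z
      proof -
        obtain x where x: "x \<in> A2" "F j x = t" "z = straighten (F j) v x - t *\<^sub>R v"
          using \<open>z \<in> At\<close> by (auto simp: At_def)
        define p where "p = z + t *\<^sub>R v"
        have px: "p = straighten (F j) v x" by (simp add: p_def x(3))
        have pQ: "p \<in> Q" and \<Psi>p: "\<Psi> p = x" using UQ x(1) A2(1) px by auto
        have pV: "p \<in> V"
          unfolding px using straighten_mem_iff[OF V v(1)] x(1) A2(2) A(2) by blast
        have xU: "x \<in> U" and xS: "x \<in> S" using x(1) A2(1) U(3) by auto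
        have der\<Psi>: "(\<Psi> has_derivative frechet_derivative \<Psi> (at p)) (at p)"
          by (rule Cr_has_derivative[OF \<Psi> pQ])
        have derF: "(F i has_derivative frechet_derivative (F i) (at x)) (at (\<Psi> p))" if "i \<in> J" for i
          unfolding \<Psi>p by (rule Cr_has_derivative[OF FS[OF that] xS])
        have derG: "frechet_derivative (G i) (at z) h =
            frechet_derivative (F i) (at x) (frechet_derivative \<Psi> (at p) h)" if "i \<in> J" for i h
        proof -
          have "((\<lambda>z. z + t *\<^sub>R v) has_derivative (\<lambda>h. h)) (at z)"
            by (auto intro!: derivative_eq_intros)
          from has_derivative_compose[OF this der\<Psi>[unfolded p_def]]
          have "((\<lambda>z. \<Psi> (z + t *\<^sub>R v)) has_derivative frechet_derivative \<Psi> (at p)) (at z)"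
            by (simp add: p_def)
          from has_derivative_compose[OF this derF[OF that, unfolded p_def]]
          have "(G i has_derivative (\<lambda>h. frechet_derivative (F i) (at x) (frechet_derivative \<Psi> (at p) h))) (at z)"
            by (simp add: G_def p_def)
          then show ?thesis by (simp add: frechet_derivative_at[symmetric])
        qed
        obtain c where c: "\<exists>j\<in>J. c j \<noteq> 0"
          "\<And>h. h \<in> V \<Longrightarrow> (\<Sum>i\<in>J. c i * frechet_derivative (F i) (at x) h) = 0"
          using rankx[OF x(1)] by blast
        have "(\<exists>i\<in>J - {j}. c i \<noteq> 0) \<and> (\<forall>h\<in>V'. (\<Sum>i\<in>J - {j}. c i *
            frechet_derivative (F i) (at x) (frechet_derivative \<Psi> (at p) h)) = 0)"
          unfolding V'_def
          by (rule slice_rank_drop[OF V _ j v(1) Q pQ pV der\<Psi> \<Psi>V derF Fj\<Psi> nz[OF xU] c]) auto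
        then show ?thesis
          by (intro exI[of _ c]) (auto simp: derG)
      qed
      moreover have "card (J - {j}) < card J"
        using j by (intro card_Diff1_less) auto
      \<comment> \<open>The left side drops by at least one and the right side by exactly one, so
        the order \<open>r\<close> can be kept.\<close>
      moreover have "dim V' + 1 \<le> r + card (J - {j})"
        using dim_hyperplane_section[OF V v(1,2)] r(2) j by (simp add: V'_def card_Diff_singleton)
      moreover have "subspace V'"
        unfolding V'_def by (rule subspace_hyperplane_section[OF V])
      ultimately have "negligible (cylinder (J - {j}) G At)"
        using \<open>open St\<close> \<open>compact At\<close> \<open>At \<subseteq> V'\<close> AtS r(1) Jj
        by (intro less.hyps[where J = "J - {j}" and V = V' and S = St]) simp_all
      \<comment> \<open>Coordinate \<open>j\<close> of the modified vector is \<open>t\<close>,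
        which forces F j x = t. The entry \<open>w $ j\<close> itself is unconstrained, as in a
        cylinder over \<open>J - {j}\<close>.\<close>
      moreover have "{w. w + (t - w $ j) *\<^sub>R axis j 1 \<in> cylinder J F A2} \<subseteq> cylinder (J - {j}) G At"
      proof
        fix w assume "w \<in> {w. w + (t - w $ j) *\<^sub>R axis j 1 \<in> cylinder J F A2}"
        then obtain x where x: "x \<in> A2"
          and w: "\<And>i. i \<in> J \<Longrightarrow> (w + (t - w $ j) *\<^sub>R axis j 1) $ i = F i x"
          by (auto simp: cylinder_def)
        have "F j x = t" using w[OF j] by (simp add: axis_def)
        moreover have "w $ i = F i x" if "i \<in> J - {j}" for i
          using w[of i] that by (simp add: axis_def)
        moreover have "\<Psi> (straighten (F j) v x) = x" using UQ x A2(1) by blast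
        ultimately show "w \<in> cylinder (J - {j}) G At"
          using x unfolding cylinder_def G_def At_def by (auto intro!: bexI[of _ x])
      qed
      ultimately show "negligible {w. w + (t - w $ j) *\<^sub>R axis j 1 \<in> cylinder J F A2}"
        using negligible_subset by blast
    qed
    moreover have "cylinder J F (A \<inter> ball a \<rho>) \<subseteq> cylinder J F A2"
      by (auto simp: cylinder_def A2_def)
    moreover have "A0 \<inter> ball a \<rho> = {}"
    proof -
      have "x \<notin> A0" if "x \<in> U" for x
        using nz[OF that] j v(1) by (auto simp: A0_def)
      moreover have "ball a \<rho> \<subseteq> U" using \<rho>(2) ball_subset_cball by blast
      ultimately show ?thesis by blast
    qed
    ultimately show ?thesis
      using \<rho>(1) negligible_subset by (intro exI[of _ "ball a \<rho>"]) auto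
  qed
  then obtain U where U: "\<And>a. a \<in> A - A0 \<Longrightarrow> open (U a) \<and> a \<in> U a \<and> A0 \<inter> U a = {} \<and>
      negligible (cylinder J F (A \<inter> U a))"
    by metis
  have "A0 \<subseteq> A" by (auto simp: A0_def)
  then have "A0 = A - (\<Union>a\<in>A - A0. U a)"
    using U by blast
  moreover have "compact (A - (\<Union>a\<in>A - A0. U a))"
    using U A(1) by (intro compact_diff open_UN) auto
  ultimately have "compact A0" by simp
  have "dim V \<le> r * card J"
  proof -
    obtain q' where "card J = Suc q'"
      using J by (metis card_eq_0_iff finite not0_implies_Suc)
    then show ?thesis using r r' by simp
  qed
  then have "negligible (cylinder J F A0)"
    using \<open>A0 \<subseteq> A\<close> A r(1)
    by (intro negligible_cylinder_flat[OF V \<open>compact A0\<close> _ _ S F _ _ J]) (auto simp: A0_def)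
  moreover obtain \<P> where \<P>: "countable \<P>" "A - A0 \<subseteq> \<Union>\<P>" "\<And>P. P \<in> \<P> \<Longrightarrow> negligible (cylinder J F P)"
  proof -
    have "\<exists>\<P>. countable \<P> \<and> A - A0 \<subseteq> \<Union>\<P> \<and> (\<forall>P\<in>\<P>. negligible (cylinder J F P))"
    proof (rule countable_family_Lindelof)
      fix a assume "a \<in> A - A0"
      then show "\<exists>U \<P>. open U \<and> a \<in> U \<and> countable \<P> \<and> (A - A0) \<inter> U \<subseteq> \<Union>\<P> \<and>
          (\<forall>P\<in>\<P>. negligible (cylinder J F P))"
        using U[of a] by (intro exI[of _ "U a"] exI[of _ "{A \<inter> U a}"]) auto
    qed
    then show ?thesis using that by blast
  qed
  moreover have "cylinder J F A \<subseteq> cylinder J F A0 \<union> (\<Union>P\<in>\<P>. cylinder J F P)"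
    using \<P>(2) by (fastforce simp: cylinder_def)
  ultimately show ?case
    using negligible_UN_countable[OF \<P>(1), of "cylinder J F"] negligible_subset negligible_Un by metis
qed

section \<open>The image of \<open>S_map\<close> below the number \<open>N_number\<close>\<close>

lemma s_vec_has_derivative:
  assumes "\<And>j. (f j has_derivative D j) (at x)"
  shows "(s_vec f has_derivative (\<lambda>u. \<chi> j. D j u)) (at x)"
  unfolding has_derivative_componentwise_within[of "s_vec f"]
  using assms by (auto simp: s_vec_def Basis_vec_def inner_axis)

text \<open>Connects the derivatives of the single components, which occur in
  \<open>Morse_Sard\<close>, with the columns that define the rank.\<close>

lemma frechet_derivative_s_vec:
  fixes f :: "'m::finite \<Rightarrow> real^'n::finite \<Rightarrow> real"
  assumes "\<And>j. (f j has_derivative D j) (at x)"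
  shows "(\<chi> j. D j u) = (\<Sum>l\<in>UNIV. u $ l *\<^sub>R partial_deriv l (s_vec f) x)"
proof -
  have der: "(s_vec f has_derivative (\<lambda>u. \<chi> j. D j u)) (at x)"
    by (rule s_vec_has_derivative[OF assms])
  have eq: "partial_deriv l (s_vec f) x = (\<chi> j. D j (axis l 1))" for l
    unfolding partial_deriv_def by (simp add: frechet_derivative_at[OF der, symmetric])
  have lin: "linear (\<lambda>u. \<chi> j. D j u)"
    using der has_derivative_linear by blast
  have "(\<chi> j. D j u) = (\<chi> j. D j (\<Sum>l\<in>UNIV. u $ l *\<^sub>R axis l 1))"
    using basis_expansion[of u] by (simp add: scalar_mult_eq_scaleR)
  also have "\<dots> = (\<Sum>l\<in>UNIV. u $ l *\<^sub>R (\<chi> j. D j (axis l 1)))"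
    using linear_sum[OF lin, of "\<lambda>l. u $ l *\<^sub>R axis l 1" UNIV] linear_cmul[OF lin] by simp
  finally show ?thesis by (simp add: eq)
qed

text \<open>The entries of \<open>a\<close> are the coefficients of the row dependence that
  \<open>Morse_Sard\<close> asks for.\<close>

lemma DS_columns_orthogonal:
  fixes f :: "'m::finite \<Rightarrow> real^'n::finite \<Rightarrow> real"
  assumes "DS_rank k f C X \<noteq> CARD('m)"
  obtains a where "a \<noteq> 0" "\<And>y. y \<in> DS_columns k f C X \<Longrightarrow> a \<bullet> y = 0"
proof -
  have "dim (DS_columns k f C X) < DIM(real^'m)"
    using assms dim_subset_UNIV[of "DS_columns k f C X"] by (simp add: DS_rank_def dim_span)
  from lowdim_subset_hyperplane[OF this]
  obtain a where "a \<noteq> 0" "span (DS_columns k f C X) \<subseteq> {x. a \<bullet> x = 0}"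
    by auto
  then show thesis
    using that[of a] span_superset[of "DS_columns k f C X"] by blast
qed

lemma dim_supported_subspace:
  fixes e :: "nat \<Rightarrow> 'm::finite"
  shows "dim {z :: 'b::euclidean_space ^ 'm. \<forall>a. a \<notin> e ` {..<k} \<longrightarrow> z $ a = 0} \<le> k * DIM('b)"
proof -
  define B where "B = (\<lambda>(i, b). axis (e i) b :: 'b ^ 'm) ` ({..<k} \<times> Basis)"
  have "finite B" by (simp add: B_def)
  have "card B \<le> k * DIM('b)"
    unfolding B_def using card_image_le[of "{..<k} \<times> (Basis :: 'b set)"] by (simp add: card_cartesian_product)
  moreover have "{z :: 'b ^ 'm. \<forall>a. a \<notin> e ` {..<k} \<longrightarrow> z $ a = 0} \<subseteq> span B"
  proof
    fix z :: "'b ^ 'm" assume "z \<in> {z. \<forall>a. a \<notin> e ` {..<k} \<longrightarrow> z $ a = 0}"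
    then have z: "\<And>a. a \<notin> e ` {..<k} \<Longrightarrow> z $ a = 0" by simp
    have "(\<Sum>b\<in>Basis. (z \<bullet> b) *\<^sub>R b) \<in> span B"
    proof (rule span_sum)
      fix b :: "'b ^ 'm" assume "b \<in> Basis"
      then obtain a u where b: "b = axis a u" "u \<in> Basis" by (auto simp: Basis_vec_def)
      show "(z \<bullet> b) *\<^sub>R b \<in> span B"
      proof (cases "a \<in> e ` {..<k}")
        case True
        then have "b \<in> B" using b by (auto simp: B_def)
        then show ?thesis by (simp add: span_base span_scale)
      next
        case False
        then show ?thesis using z b by (simp add: inner_axis span_zero)
      qed
    qed
    then show "z \<in> span B" by (simp add: euclidean_representation)
  qed
  ultimately show ?thesis
    using dim_le_card[of _ B] \<open>finite B\<close> by (meson order_trans)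
qed

text \<open>
  The variable \<open>(C, X)\<close> ranges over a space whose dimension depends on \<open>k\<close>. For \<open>k \<le> m\<close> it is realized
  as the subspace of \<open>(real \<times> (real^'n))^'m\<close> of vectors supported on \<open>k\<close> fixed coordinates.
\<close>

theorem negligible_S_map_image:
  fixes f :: "'m::finite \<Rightarrow> real^'n::finite \<Rightarrow> real"
  assumes f: "\<And>j. C_diff r (f j)" and k: "k \<le> CARD('m)"
    and r: "1 \<le> r" "k * (CARD('n) + 1) + 1 \<le> r + CARD('m)"
    and rank: "\<And>C X. (\<And>i. i < k \<Longrightarrow> 0 \<le> C i) \<Longrightarrow> DS_rank k f C X \<noteq> CARD('m)"
  shows "negligible {S_map k f C X |C X. \<forall>i<k. 0 \<le> C i}"
proof -
  \<comment> \<open>Here k \<le> m is used: \<open>k\<close> different coordinates carry the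
    \<open>k\<close> atoms.\<close>
  obtain e :: "nat \<Rightarrow> 'm" where e: "inj_on e {..<k}"
  proof -
    obtain I :: "'m set" where "card I = k"
      using k obtain_subset_with_card_n[of k "UNIV :: 'm set"] by auto
    then obtain e where "bij_betw e {0..<k} I"
      using ex_bij_betw_nat_finite[of I] finite[of I] by blast
    then show thesis
      using that[of e] by (simp add: bij_betw_def atLeast0LessThan)
  qed
  define V :: "((real \<times> (real^'n))^'m) set" where "V = {z. \<forall>a. a \<notin> e ` {..<k} \<longrightarrow> z $ a = 0}"
  define F :: "'m \<Rightarrow> (real \<times> (real^'n))^'m \<Rightarrow> real"
    where "F = (\<lambda>j z. \<Sum>i<k. fst (z $ e i) * f j (snd (z $ e i)))"
  \<comment> \<open>A compact exhaustion of the admissible parameters. The sign condition is kept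
    because the rank hypothesis is available only for nonnegative weights.\<close>
  define A where "A = (\<lambda>n. {z \<in> V. norm z \<le> real n \<and> (\<forall>i<k. 0 \<le> fst (z $ e i))})"
  have V: "subspace V"
    unfolding subspace_def by (auto simp: V_def)
  have dimV: "dim V \<le> k * (CARD('n) + 1)"
    using dim_supported_subspace[of e k, where 'b = "real \<times> (real^'n)"] by (simp add: V_def)
  have Crf: "Cr r UNIV (f j)" for j by (rule C_diff_imp_Cr[OF f])
  have bl1: "bounded_linear (\<lambda>z :: (real \<times> (real^'n))^'m. fst (z $ a))"
    and bl2: "bounded_linear (\<lambda>z :: (real \<times> (real^'n))^'m. snd (z $ a))" for a
    using bounded_linear_compose[OF bounded_linear_fst bounded_linear_vec_nth]
      bounded_linear_compose[OF bounded_linear_snd bounded_linear_vec_nth] by auto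
  have CrF: "Cr r UNIV (F j)" for j
  proof -
    have "Cr r UNIV (\<lambda>z :: (real \<times> (real^'n))^'m. f j (snd (z $ a)))" for a
      by (rule Cr_compose[where f = "f j" and g = "\<lambda>z. snd (z $ a)", OF _ _ Crf])
        (auto intro: Cr_bounded_linear bl2)
    then show ?thesis
      unfolding F_def by (intro Cr_sum Cr_mult Cr_bounded_linear[OF _ bl1]) auto
  qed
  obtain r' where r': "r = Suc r'" using r(1) by (cases r) auto
  have "negligible (cylinder UNIV F (A n))" for n
  proof (rule Morse_Sard[OF V open_UNIV])
    have "closed {z :: (real \<times> (real^'n))^'m. 0 \<le> fst (z $ a)}" for a
      by (intro closed_Collect_le continuous_intros)
    then have "closed (\<Inter>i\<in>{..<k}. {z :: (real \<times> (real^'n))^'m. 0 \<le> fst (z $ e i)})"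
      by (intro closed_INT) auto
    then have "compact (cball 0 (real n) \<inter> (V \<inter> (\<Inter>i\<in>{..<k}. {z. 0 \<le> fst (z $ e i)})))"
      using closed_subspace[OF V] by (intro compact_Int_closed compact_cball closed_Int)
    moreover have "A n = cball 0 (real n) \<inter> (V \<inter> (\<Inter>i\<in>{..<k}. {z. 0 \<le> fst (z $ e i)}))"
      by (auto simp: A_def)
    ultimately show "compact (A n)" by simp
    show "A n \<subseteq> V" "A n \<subseteq> UNIV" by (auto simp: A_def)
    show "Cr r UNIV (F j)" for j by (rule CrF)
    show "1 \<le> r" by (rule r)
    show "dim V + 1 \<le> r + card (UNIV :: 'm set)" using dimV r(2) by linarith
    show "(UNIV :: 'm set) \<noteq> {}" by simp
  next
    fix z assume z: "z \<in> A n"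
    define C where "C = (\<lambda>i. fst (z $ e i))"
    define X where "X = (\<lambda>i. snd (z $ e i))"
    define D where "D = (\<lambda>j x. frechet_derivative (f j) (at x))"
    have Df: "(f j has_derivative D j x) (at x)" for j x
      unfolding D_def using Cr_has_derivative[of r' UNIV "f j" x] Crf r' by simp
    have DF: "frechet_derivative (F j) (at z) h =
        (\<Sum>i<k. C i * D j (X i) (snd (h $ e i)) + fst (h $ e i) * f j (X i))" for j h
    proof -
      have "((\<lambda>z. f j (snd (z $ a))) has_derivative (\<lambda>h. D j (snd (z $ a)) (snd (h $ a)))) (at z)" for a
        by (rule has_derivative_compose[OF bounded_linear_imp_has_derivative[OF bl2] Df])
      then have "(F j has_derivative
          (\<lambda>h. \<Sum>i<k. C i * D j (X i) (snd (h $ e i)) + fst (h $ e i) * f j (X i))) (at z)"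
        unfolding F_def C_def X_def
        by (intro has_derivative_sum has_derivative_mult bounded_linear_imp_has_derivative bl1)
      then show ?thesis
        by (simp add: frechet_derivative_at[symmetric])
    qed
    have "\<And>i. i < k \<Longrightarrow> 0 \<le> C i" using z by (simp add: A_def C_def)
    then obtain a where a: "a \<noteq> 0" "\<And>y. y \<in> DS_columns k f C X \<Longrightarrow> a \<bullet> y = 0"
      using DS_columns_orthogonal[OF rank] by metis
    have a1: "(\<Sum>j\<in>UNIV. a $ j * f j (X i)) = 0" if "i < k" for i
      using a(2)[of "s_vec f (X i)"] that by (auto simp: DS_columns_def inner_vec_def s_vec_def)
    \<comment> \<open>The columns control only C i times the derivatives, so at C i = 0 nothing is
      known about the derivatives themselves. The derivative of \<open>F j\<close> contains the same
      factor, so this is enough.\<close>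
    have a2: "C i * (\<Sum>j\<in>UNIV. a $ j * D j (X i) u) = 0" if "i < k" for i u
    proof -
      have "C i * (\<Sum>j\<in>UNIV. a $ j * D j (X i) u) = C i * (a \<bullet> (\<chi> j. D j (X i) u))"
        by (simp add: inner_vec_def)
      also have "\<dots> = (\<Sum>l\<in>UNIV. u $ l * (a \<bullet> (C i *\<^sub>R partial_deriv l (s_vec f) (X i))))"
        unfolding frechet_derivative_s_vec[OF Df]
        by (simp add: inner_sum_right sum_distrib_left mult_ac)
      also have "\<dots> = 0"
      proof (rule sum.neutral, rule ballI)
        fix l
        have "C i *\<^sub>R partial_deriv l (s_vec f) (X i) \<in> DS_columns k f C X"
          using that by (auto simp: DS_columns_def)
        from a(2)[OF this]
        show "u $ l * (a \<bullet> (C i *\<^sub>R partial_deriv l (s_vec f) (X i))) = 0"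
          by (simp only: mult_zero_right)
      qed
      finally show ?thesis .
    qed
    have "(\<Sum>j\<in>UNIV. a $ j * frechet_derivative (F j) (at z) h) = 0" for h
    proof -
      have "(\<Sum>j\<in>UNIV. a $ j * frechet_derivative (F j) (at z) h) =
          (\<Sum>i<k. \<Sum>j\<in>UNIV. a $ j * (C i * D j (X i) (snd (h $ e i)) + fst (h $ e i) * f j (X i)))"
        unfolding DF sum_distrib_left by (rule sum.swap)
      also have "\<dots> = (\<Sum>i<k. C i * (\<Sum>j\<in>UNIV. a $ j * D j (X i) (snd (h $ e i))) +
          fst (h $ e i) * (\<Sum>j\<in>UNIV. a $ j * f j (X i)))"
        by (simp add: distrib_left sum.distrib sum_distrib_left mult_ac)
      also have "\<dots> = 0"
        proof (rule sum.neutral, rule ballI)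
        fix i assume "i \<in> {..<k}"
        then have "i < k" by simp
        show "C i * (\<Sum>j\<in>UNIV. a $ j * D j (X i) (snd (h $ e i))) +
            fst (h $ e i) * (\<Sum>j\<in>UNIV. a $ j * f j (X i)) = 0"
          unfolding a1[OF \<open>i < k\<close>] a2[OF \<open>i < k\<close>] by simp
      qed
      finally show ?thesis .
    qed
    moreover have "\<exists>j. a $ j \<noteq> 0" using a(1) by (auto simp: vec_eq_iff)
    ultimately show "\<exists>c. (\<exists>j\<in>UNIV. c j \<noteq> 0) \<and> (\<forall>v\<in>V. (\<Sum>j\<in>UNIV. c j * frechet_derivative (F j) (at z) v) = 0)"
      by (intro exI[of _ "\<lambda>j. a $ j"]) simp
  qed
  then have "negligible (\<Union>n\<in>UNIV. cylinder UNIV F (A n))"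
    by (intro negligible_UN_countable) auto
  moreover have "{S_map k f C X |C X. \<forall>i<k. 0 \<le> C i} \<subseteq> (\<Union>n\<in>UNIV. cylinder UNIV F (A n))"
  proof
    fix s assume "s \<in> {S_map k f C X |C X. \<forall>i<k. 0 \<le> C i}"
    then obtain C X where s: "s = S_map k f C X" and C: "\<And>i. i < k \<Longrightarrow> 0 \<le> C i" by auto
    define d where "d = inv_into {..<k} e"
    define z :: "(real \<times> (real^'n))^'m" where "z = (\<chi> a. if a \<in> e ` {..<k} then (C (d a), X (d a)) else 0)"
    have ze: "z $ e i = (C i, X i)" if "i < k" for i
      using that e by (simp add: z_def d_def)
    obtain n where "norm z \<le> real n" using real_arch_simple by blast
    then have "z \<in> A n"
      using C ze by (auto simp: A_def V_def z_def)
    moreover have "s $ j = F j z" for j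
      using ze by (simp add: s F_def S_map_def s_vec_def)
    ultimately show "s \<in> (\<Union>n\<in>UNIV. cylinder UNIV F (A n))"
      by (auto simp: cylinder_def)
  qed
  ultimately show ?thesis
    using negligible_subset by blast
qed

section \<open>Atomic measures and Richter's theorem\<close>

text \<open>The image of a point measure on the indices, so that integrals become finite sums;
  coinciding points are permitted and their weights add up.\<close>

definition sum_of_diracs :: "nat \<Rightarrow> (nat \<Rightarrow> real) \<Rightarrow> (nat \<Rightarrow> real^'n::finite) \<Rightarrow> (real^'n) measure" where
  "sum_of_diracs k c x = distr (point_measure {..<k} (\<lambda>i. ennreal (c i))) borel x"

lemma emeasure_sum_of_diracs:
  assumes "B \<in> sets borel"
  shows "emeasure (sum_of_diracs k c x) B = (\<Sum>i<k. ennreal (c i) * indicator B (x i))"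
proof -
  have "emeasure (sum_of_diracs k c x) B = (\<Sum>i\<in>x -` B \<inter> {..<k}. ennreal (c i))"
    using assms unfolding sum_of_diracs_def
    by (subst emeasure_distr) (auto simp: space_point_measure emeasure_point_measure_finite)
  also have "\<dots> = (\<Sum>i<k. if i \<in> x -` B then ennreal (c i) else 0)"
    by (subst sum.inter_restrict[symmetric]) (auto simp: Int_commute)
  also have "\<dots> = (\<Sum>i<k. ennreal (c i) * indicator B (x i))"
    by (rule sum.cong) (auto simp: indicator_def)
  finally show ?thesis .
qed

lemma integral_sum_of_diracs:
  fixes g :: "real^'n::finite \<Rightarrow> real"
  assumes "g \<in> borel_measurable borel" "\<And>i. i < k \<Longrightarrow> 0 \<le> c i"
  shows "integrable (sum_of_diracs k c x) g" "(\<integral>y. g y \<partial>(sum_of_diracs k c x)) = (\<Sum>i<k. c i * g (x i))"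
proof -
  show "integrable (sum_of_diracs k c x) g"
    unfolding sum_of_diracs_def using assms
    by (subst integrable_distr_eq) (auto intro: integrable_point_measure_finite)
  have "(\<integral>y. g y \<partial>(sum_of_diracs k c x)) = (\<integral>i. g (x i) \<partial>(point_measure {..<k} (\<lambda>i. ennreal (c i))))"
    unfolding sum_of_diracs_def using assms by (intro integral_distr) auto
  also have "\<dots> = (\<Sum>i<k. c i * g (x i))"
    using assms(2) by (subst lebesgue_integral_point_measure_finite) auto
  finally show "(\<integral>y. g y \<partial>(sum_of_diracs k c x)) = (\<Sum>i<k. c i * g (x i))" .
qed

text \<open>Inner regularity is attained: the finitely many atoms inside \<open>B\<close> form a
  compact subset of the same measure.\<close>

lemma radon_sum_of_diracs: "radon_measure (sum_of_diracs k c x)"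
  unfolding radon_measure_def
proof (intro conjI allI impI ballI)
  let ?M = "sum_of_diracs k c x"
  show sets: "sets ?M = sets borel" by (simp add: sum_of_diracs_def)
  show "emeasure ?M K < \<infinity>" if "compact K" for K
    using that by (subst emeasure_sum_of_diracs) (auto simp: compact_imp_closed ennreal_mult_less_top indicator_def)
  fix B :: "(real^'a) set" assume B: "B \<in> sets borel"
  let ?K = "x ` {i. i < k \<and> x i \<in> B}"
  have K: "compact ?K" "?K \<subseteq> B"
    by (auto intro: finite_imp_compact)
  have "emeasure ?M B = emeasure ?M ?K"
    using B by (subst (1 2) emeasure_sum_of_diracs)
      (auto simp: K(1) compact_imp_closed indicator_def intro!: sum.cong)
  show "emeasure ?M B = (SUP K\<in>{K. compact K \<and> K \<subseteq> B}. emeasure ?M K)"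
  proof (rule antisym)
    show "emeasure ?M B \<le> (SUP K\<in>{K. compact K \<and> K \<subseteq> B}. emeasure ?M K)"
      using K \<open>emeasure ?M B = emeasure ?M ?K\<close> by (auto intro: SUP_upper2)
    show "(SUP K\<in>{K. compact K \<and> K \<subseteq> B}. emeasure ?M K) \<le> emeasure ?M B"
      using B by (intro SUP_least emeasure_mono) (auto simp: sets)
  qed
qed

lemma S_map_nth: "S_map k f C X $ j = (\<Sum>i<k. C i * f j (X i))"
  by (simp add: S_map_def s_vec_def)

lemma atomic_representable_S_map:
  fixes f :: "'m::finite \<Rightarrow> real^'n::finite \<Rightarrow> real"
  assumes "\<And>j. f j \<in> borel_measurable borel" "\<And>i. i < k \<Longrightarrow> 0 < c i" "inj_on x {..<k}"
  shows "atomic_representable k f (S_map k f c x)"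
  unfolding atomic_representable_def atomic_measure_def represents_def
proof (intro exI[of _ "sum_of_diracs k c x"] conjI allI)
  show "sets (sum_of_diracs k c x) = sets borel" by (simp add: sum_of_diracs_def)
  show "\<exists>c' x'. (\<forall>i<k. 0 < c' i) \<and> inj_on x' {..<k} \<and>
      (\<forall>B\<in>sets borel. emeasure (sum_of_diracs k c x) B = (\<Sum>i<k. ennreal (c' i) * indicator B (x' i)))"
    using assms by (intro exI[of _ c] exI[of _ x]) (auto simp: emeasure_sum_of_diracs)
  show "radon_measure (sum_of_diracs k c x)" by (rule radon_sum_of_diracs)
  fix j
  have "\<And>i. i < k \<Longrightarrow> 0 \<le> c i" using assms(2) less_imp_le by blast
  from integral_sum_of_diracs[OF assms(1) this]
  show "integrable (sum_of_diracs k c x) (f j)"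
    "S_map k f c x $ j = (\<integral>y. f j y \<partial>(sum_of_diracs k c x))"
    by (auto simp: S_map_nth)
qed

lemma atomic_representableD:
  fixes f :: "'m::finite \<Rightarrow> real^'n::finite \<Rightarrow> real"
  assumes "\<And>j. f j \<in> borel_measurable borel" "atomic_representable k f s"
  obtains C X where "\<And>i. i < k \<Longrightarrow> 0 \<le> C i" "s = S_map k f C X"
proof -
  obtain \<mu> c x where \<mu>: "sets \<mu> = sets borel" and c: "\<forall>i<k. 0 < c i"
    and em: "\<And>B. B \<in> sets borel \<Longrightarrow> emeasure \<mu> B = (\<Sum>i<k. ennreal (c i) * indicator B (x i))"
    and s: "\<And>j. s $ j = (\<integral>y. f j y \<partial>\<mu>)"
    using assms(2) unfolding atomic_representable_def atomic_measure_def represents_def by auto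
  have "\<mu> = sum_of_diracs k c x"
    by (rule measure_eqI) (auto simp: \<mu> em emeasure_sum_of_diracs sum_of_diracs_def[THEN arg_cong[where f=sets]])
  moreover have "\<And>i. i < k \<Longrightarrow> 0 \<le> c i" using c less_imp_le by blast
  ultimately have "s = S_map k f c x"
    using integral_sum_of_diracs(2)[OF assms(1), of k c x] by (simp add: vec_eq_iff s S_map_nth)
  then show thesis
    using that[of c x] c by (auto intro: less_imp_le)
qed

lemma integral_inner_s_vec:
  assumes "represents \<mu> f s"
  shows "integrable \<mu> (\<lambda>x. a \<bullet> s_vec f x)" "(\<integral>x. a \<bullet> s_vec f x \<partial>\<mu>) = a \<bullet> s"
  using assms by (auto simp: represents_def inner_vec_def s_vec_def intro!: Bochner_Integration.integrable_sum)

text \<open>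
  If \<open>s\<close> is not in the cone, then a linear functional separating \<open>s\<close> from it, restricted to the span of
  the cone, must vanish almost everywhere, and the dimension drops.
\<close>

lemma Richter_cone:
  fixes f :: "'m::finite \<Rightarrow> real^'n::finite \<Rightarrow> real"
  assumes "represents \<mu> f s" "AE x in \<mu>. x \<in> Z"
  shows "s \<in> convex_cone hull (s_vec f ` Z)"
  using assms(2)
proof (induction "dim (s_vec f ` Z)" arbitrary: Z rule: less_induct)
  case less
  define K where "K = convex_cone hull (s_vec f ` Z)"
  define L where "L = span (s_vec f ` Z)"
  have cone: "convex_cone K" by (simp add: K_def convex_cone_convex_cone_hull)
  have "K \<subseteq> L"
    unfolding K_def L_def by (rule hull_minimal) (auto simp: span_superset subspace_imp_convex_cone)
  have sub: "s_vec f ` Z \<subseteq> K" unfolding K_def by (rule hull_subset)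
  show ?case
  proof (rule ccontr)
    assume "s \<notin> convex_cone hull (s_vec f ` Z)"
    then have "s \<notin> K" by (simp add: K_def)
    \<comment> \<open>The component \<open>z\<close> of \<open>s\<close> orthogonal to
      \<open>L\<close> is orthogonal to almost all values of \<open>s_vec f\<close>, hence to their
      integral \<open>s\<close>.\<close>
    have "s \<in> L"
    proof -
      obtain y z where yz: "y \<in> L" "\<And>w. w \<in> L \<Longrightarrow> orthogonal z w" "s = y + z"
        using orthogonal_subspace_decomp_exists[of "s_vec f ` Z" s] by (auto simp: L_def)
      have "AE x in \<mu>. z \<bullet> s_vec f x = 0"
        using less.prems
      proof eventually_elim
        case (elim x)
        then have "s_vec f x \<in> L" by (auto simp: L_def intro: span_base)
        then show ?case using yz(2) by (simp add: orthogonal_def)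
      qed
      then have "z \<bullet> s = 0"
        using integral_inner_s_vec(2)[OF assms(1), of z] integral_eq_zero_AE by metis
      moreover have "z \<bullet> y = 0" using yz(1,2) by (simp add: orthogonal_def)
      ultimately have "z = 0" by (simp add: yz(3) inner_add_right)
      then show ?thesis using yz by simp
    qed
    have "convex K" using cone by (simp add: convex_cone_def)
    have "0 \<in> K" by (simp add: K_def convex_cone_hull_contains_0)
    \<comment> \<open>The cone need not be closed, so the separation is only weak and gives no
      contradiction by itself. Choosing \<open>a\<close> with \<open>s + a\<close> in the affine
      hull puts \<open>a\<close> into \<open>L\<close>, which is what makes the span of the smaller
      set strictly smaller.\<close>
    with \<open>convex K\<close> obtain a b where a: "s + a \<in> affine hull (insert s K)" "a \<noteq> 0" "a \<bullet> s \<le> b"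
      "\<And>x. x \<in> K \<Longrightarrow> a \<bullet> x \<ge> b"
      using separating_hyperplane_set_point_inaff[OF _ _ \<open>s \<notin> K\<close>] by (metis empty_iff)
    have "affine hull (insert s K) \<subseteq> L"
      using \<open>K \<subseteq> L\<close> \<open>s \<in> L\<close> by (intro hull_minimal) (auto simp: L_def subspace_imp_affine)
    then have "s + a \<in> L" using a(1) by blast
    then have "a \<in> L"
      using \<open>s \<in> L\<close> unfolding L_def by (metis add_diff_cancel_left' span_diff)
    have "b \<le> 0" using a(4)[OF \<open>0 \<in> K\<close>] by simp
    have nonneg: "0 \<le> a \<bullet> x" if "x \<in> K" for x
    proof (rule ccontr)
      assume neg: "\<not> 0 \<le> a \<bullet> x"
      \<comment> \<open>Scaled so that the functional takes the value b - 1 at t x, below the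
        separation bound.\<close>
      define t where "t = (b - 1) / (a \<bullet> x)"
      have "0 \<le> t" using neg \<open>b \<le> 0\<close> by (simp add: t_def divide_nonpos_neg)
      then have "t *\<^sub>R x \<in> K"
        unfolding K_def using that by (intro convex_cone_hull_mul) (simp add: K_def)
      then have "b \<le> t * (a \<bullet> x)" using a(4) by fastforce
      then show False using neg by (simp add: t_def)
    qed
    have AEnn: "AE x in \<mu>. 0 \<le> a \<bullet> s_vec f x"
      using less.prems by eventually_elim (use nonneg sub in auto)
    have "a \<bullet> s = 0"
      using integral_nonneg_AE[OF AEnn] integral_inner_s_vec(2)[OF assms(1), of a] a(3) \<open>b \<le> 0\<close> by simp
    then have "AE x in \<mu>. a \<bullet> s_vec f x = 0"
      using integral_nonneg_eq_0_iff_AE[OF integral_inner_s_vec(1)[OF assms(1)] AEnn]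
        integral_inner_s_vec(2)[OF assms(1), of a] by simp
    define Z' where "Z' = Z \<inter> {x. a \<bullet> s_vec f x = 0}"
    have AEZ': "AE x in \<mu>. x \<in> Z'"
      using less.prems \<open>AE x in \<mu>. a \<bullet> s_vec f x = 0\<close> by eventually_elim (simp add: Z'_def)
    have "span (s_vec f ` Z') \<subseteq> {y. a \<bullet> y = 0}"
      by (rule span_minimal) (auto simp: Z'_def subspace_hyperplane)
    moreover have "a \<bullet> a \<noteq> 0" using a(2) by simp
    ultimately have "a \<notin> span (s_vec f ` Z')" by blast
    moreover have "span (s_vec f ` Z') \<subseteq> span (s_vec f ` Z)"
      by (intro span_mono) (auto simp: Z'_def)
    ultimately have "span (s_vec f ` Z') \<subset> span (s_vec f ` Z)"
      using \<open>a \<in> L\<close> by (auto simp: L_def)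
    then have "s \<in> convex_cone hull (s_vec f ` Z')"
      by (intro less.hyps dim_psubset AEZ')
    moreover have "convex_cone hull (s_vec f ` Z') \<subseteq> K"
      unfolding K_def by (intro hull_mono) (auto simp: Z'_def)
    ultimately show False using \<open>s \<notin> K\<close> by blast
  qed
qed

text \<open>The cone consists of multiples of points of the convex hull, where Caratheodory's
  theorem in dimension m gives m + 1 points. Uniformity of the bound in \<open>s\<close> makes the
  minimum in \<open>caratheodory_number\<close> exist.\<close>

lemma convex_cone_atomic_representable:
  fixes f :: "'m::finite \<Rightarrow> real^'n::finite \<Rightarrow> real"
  assumes f: "\<And>j. f j \<in> borel_measurable borel" and s: "s \<in> convex_cone hull (range (s_vec f))"
  shows "\<exists>k\<le>CARD('m) + 1. atomic_representable k f s"
proof -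
  have "s \<in> (\<Union>x \<in> convex hull (range (s_vec f)). \<Union>c\<in>{0..}. {c *\<^sub>R x})"
    using s convex_cone_hull_convex_hull_nonempty[of "range (s_vec f)"] by simp
  then obtain y t where y: "y \<in> convex hull (range (s_vec f))" and "0 \<le> t" and sty: "s = t *\<^sub>R y"
    by auto
  obtain S where S: "finite S" "S \<subseteq> range (s_vec f)" "card S \<le> CARD('m) + 1" "y \<in> convex hull S"
    using y caratheodory[of "range (s_vec f)"] by auto
  then obtain u where u: "\<forall>v\<in>S. 0 \<le> u v" "y = (\<Sum>v\<in>S. u v *\<^sub>R v)"
    using convex_hull_finite[OF S(1)] by auto
  \<comment> \<open>Discarding zero weights makes all atoms genuine; for t = 0 this leaves the zero
    measure with k = 0.\<close>
  define T where "T = {v \<in> S. 0 < t * u v}"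
  define k where "k = card T"
  have "finite T" using S(1) by (simp add: T_def)
  then obtain h where h: "bij_betw h {..<k} T"
    unfolding k_def using ex_bij_betw_nat_finite atLeast0LessThan by metis
  have hT: "h i \<in> T" if "i < k" for i using h that by (auto simp: bij_betw_def)
  \<comment> \<open>One preimage per vector: different vectors come from different points, so the
    atoms are distinct.\<close>
  define g where "g = inv_into UNIV (s_vec f)"
  have g: "s_vec f (g v) = v" if "v \<in> T" for v
    using that S(2) unfolding g_def T_def by (intro f_inv_into_f) auto
  have "s = (\<Sum>v\<in>S. (t * u v) *\<^sub>R v)"
    by (simp add: sty u(2) scaleR_sum_right)
  also have "\<dots> = (\<Sum>v\<in>T. (t * u v) *\<^sub>R v)"
    using S(1) u(1) \<open>0 \<le> t\<close> by (intro sum.mono_neutral_right) (auto simp: T_def zero_less_mult_iff not_less order_le_less)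
  also have "\<dots> = (\<Sum>i<k. (t * u (h i)) *\<^sub>R h i)"
    using sum.reindex_bij_betw[OF h, of "\<lambda>v. (t * u v) *\<^sub>R v"] by simp
  also have "\<dots> = S_map k f (\<lambda>i. t * u (h i)) (g \<circ> h)"
    unfolding S_map_def using g hT by (intro sum.cong) auto
  finally have "s = S_map k f (\<lambda>i. t * u (h i)) (g \<circ> h)" .
  moreover have "inj_on (g \<circ> h) {..<k}"
  proof (rule comp_inj_on)
    show "inj_on h {..<k}" using h by (simp add: bij_betw_def)
    have "inj_on g T" by (rule inj_on_inverseI[of _ "s_vec f"]) (rule g)
    then show "inj_on g (h ` {..<k})" using h by (simp add: bij_betw_def)
  qed
  moreover have "0 < t * u (h i)" if "i < k" for i
    using hT[OF that] by (simp add: T_def)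
  moreover have "k \<le> CARD('m) + 1"
    using S(1,3) card_mono[of S T] by (simp add: k_def T_def)
  ultimately show ?thesis
    using atomic_representable_S_map[where f = f, OF f, of k "\<lambda>i. t * u (h i)" "g \<circ> h"] by auto
qed

lemma moment_sequences_eq_cone:
  fixes f :: "'m::finite \<Rightarrow> real^'n::finite \<Rightarrow> real"
  assumes "\<And>j. f j \<in> borel_measurable borel"
  shows "moment_sequences f = convex_cone hull (range (s_vec f))"
proof (intro subset_antisym subsetI)
  fix s assume "s \<in> moment_sequences f"
  then show "s \<in> convex_cone hull (range (s_vec f))"
    using Richter_cone[of _ f s UNIV] by (auto simp: moment_sequences_def)
next
  fix s assume "s \<in> convex_cone hull (range (s_vec f))"
  then show "s \<in> moment_sequences f"
    using convex_cone_atomic_representable[of f s, OF assms]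
    by (auto simp: moment_sequences_def atomic_representable_def)
qed

lemma caratheodory_number_works:
  fixes f :: "'m::finite \<Rightarrow> real^'n::finite \<Rightarrow> real"
  assumes "\<And>j. f j \<in> borel_measurable borel" "s \<in> moment_sequences f"
  shows "\<exists>k\<le>caratheodory_number f. atomic_representable k f s"
proof -
  have "\<forall>s\<in>moment_sequences f. \<exists>k\<le>CARD('m) + 1. atomic_representable k f s"
    unfolding moment_sequences_eq_cone[of f, OF assms(1)]
    by (intro ballI convex_cone_atomic_representable[of f, OF assms(1)])
  then have "\<forall>s\<in>moment_sequences f. \<exists>k\<le>caratheodory_number f. atomic_representable k f s"
    unfolding caratheodory_number_def by (rule LeastI)
  then show ?thesis using assms(2) by blast
qed

section \<open>The number \<open>N_number\<close>\<close>

text \<open>A hyperplane containing all values would be a linear relation among the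
  functions.\<close>

lemma span_s_vec:
  fixes f :: "'m::finite \<Rightarrow> real^'n::finite \<Rightarrow> real"
  assumes "lin_indep f"
  shows "span (range (s_vec f)) = UNIV"
proof (rule ccontr)
  assume "span (range (s_vec f)) \<noteq> UNIV"
  then obtain a where a: "a \<noteq> 0" "span (range (s_vec f)) \<subseteq> {x. a \<bullet> x = 0}"
    using span_not_univ_subset_hyperplane by blast
  then have "a \<bullet> s_vec f x = 0" for x
    using span_base[of "s_vec f x" "range (s_vec f)"] by auto
  then have "\<forall>x. (\<Sum>j\<in>UNIV. a $ j * f j x) = 0"
    by (simp add: inner_vec_def s_vec_def)
  then have "\<forall>j. a $ j = 0"
    using assms unfolding lin_indep_def by blast
  then show False using a(1) by (simp add: vec_eq_iff)
qed

lemma not_negligible_moment_sequences: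
  fixes f :: "'m::finite \<Rightarrow> real^'n::finite \<Rightarrow> real"
  assumes "\<And>j. f j \<in> borel_measurable borel" "lin_indep f"
  shows "\<not> negligible (moment_sequences f)"
proof -
  let ?K = "convex_cone hull (range (s_vec f))"
  have "convex ?K"
    using convex_cone_convex_cone_hull[of "range (s_vec f)"] unfolding convex_cone_def by blast
  have "0 \<in> ?K" by (rule convex_cone_hull_contains_0)
  have "range (s_vec f) \<subseteq> ?K" by (rule hull_subset)
  then have "span ?K = UNIV"
    using span_mono span_s_vec[OF assms(2)] by blast
  then have "affine hull ?K = UNIV"
    using affine_hull_span_0[of ?K] hull_inc[OF \<open>0 \<in> ?K\<close>] by simp
  then have "interior ?K \<noteq> {}"
    using rel_interior_interior rel_interior_eq_empty[OF \<open>convex ?K\<close>] \<open>0 \<in> ?K\<close> by blast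
  then show ?thesis
    using negligible_convex_interior[OF \<open>convex ?K\<close>] moment_sequences_eq_cone[of f, OF assms(1)] by simp
qed

text \<open>Values of \<open>s_vec f\<close> at suitable points already form a basis, so zero
  weights, which kill the derivative columns, are enough. The minimum defining
  \<open>N_number\<close> is therefore over a nonempty set.\<close>

lemma DS_rank_full_at_basis:
  fixes f :: "'m::finite \<Rightarrow> real^'n::finite \<Rightarrow> real"
  assumes "lin_indep f"
  shows "\<exists>X. DS_rank CARD('m) f (\<lambda>i. 0) X = CARD('m)"
proof -
  obtain B where B: "B \<subseteq> range (s_vec f)" "independent B" "range (s_vec f) \<subseteq> span B"
    "card B = dim (range (s_vec f))"
    using basis_exists by blast
  have "dim (range (s_vec f)) = CARD('m)"
    using span_s_vec[OF assms] dim_eq_full[of "range (s_vec f)"] by simp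
  then have cB: "card B = CARD('m)" using B(4) by simp
  obtain h where h: "bij_betw h {..<CARD('m)} B"
    using ex_bij_betw_nat_finite[OF independent_imp_finite[OF B(2)]] cB atLeast0LessThan by metis
  define X where "X = (\<lambda>i. inv_into UNIV (s_vec f) (h i))"
  have X: "s_vec f (X i) = h i" if "i < CARD('m)" for i
    using that h B(1) unfolding X_def by (intro f_inv_into_f) (auto simp: bij_betw_def)
  have "B \<subseteq> DS_columns CARD('m) f (\<lambda>i. 0) X"
  proof
    fix b assume "b \<in> B"
    then obtain i where "i < CARD('m)" "b = s_vec f (X i)" using h X by (force simp: bij_betw_def)
    then show "b \<in> DS_columns CARD('m) f (\<lambda>i. 0) X" by (auto simp: DS_columns_def)
  qed
  then have "span (DS_columns CARD('m) f (\<lambda>i. 0) X) = UNIV"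
    using span_mono[of B] span_minimal[OF B(3)] span_s_vec[OF assms] by auto
  then have "DS_rank CARD('m) f (\<lambda>i. 0) X = CARD('m)"
    unfolding DS_rank_def by (simp only: dim_UNIV) simp
  then show ?thesis by blast
qed

lemma card_DS_columns: "finite (DS_columns k f C X)" "card (DS_columns k f C X) \<le> k * (CARD('n) + 1)"
  for f :: "'m::finite \<Rightarrow> real^'n::finite \<Rightarrow> real"
proof -
  let ?P = "(\<lambda>i. s_vec f (X i)) ` {..<k}"
    and ?Q = "(\<lambda>(i, l). C i *\<^sub>R partial_deriv l (s_vec f) (X i)) ` ({..<k} \<times> UNIV)"
  have eq: "DS_columns k f C X = ?P \<union> ?Q"
    by (auto simp: DS_columns_def)
  show "finite (DS_columns k f C X)" unfolding eq by simp
  have "card (?P \<union> ?Q) \<le> card ?P + card ?Q" by (rule card_Un_le)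
  also have "\<dots> \<le> card {..<k} + card ({..<k} \<times> (UNIV :: 'n set))"
    by (intro add_mono card_image_le) auto
  finally show "card (DS_columns k f C X) \<le> k * (CARD('n) + 1)"
    unfolding eq by (simp add: card_cartesian_product)
qed

text \<open>The first bound leaves room for the atoms among m coordinates. The second, obtained by
  counting columns, makes the assumption on \<open>r\<close> imply r \<ge> 1, so that derivatives
  exist.\<close>

lemma N_number_works:
  fixes f :: "'m::finite \<Rightarrow> real^'n::finite \<Rightarrow> real"
  assumes "lin_indep f"
  shows "N_number f \<le> CARD('m)" "CARD('m) \<le> N_number f * (CARD('n) + 1)"
proof -
  let ?P = "\<lambda>k. \<exists>C X. (\<forall>i<k. 0 \<le> C i) \<and> DS_rank k f C X = CARD('m)"
  have P: "?P CARD('m)"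
    using DS_rank_full_at_basis[OF assms] by (metis order_refl)
  then show "N_number f \<le> CARD('m)"
    unfolding N_number_def by (rule Least_le)
  have "?P (N_number f)"
    using P unfolding N_number_def by (rule LeastI)
  then obtain C X where "DS_rank (N_number f) f C X = CARD('m)" by auto
  then have "CARD('m) = dim (DS_columns (N_number f) f C X)"
    by (simp add: DS_rank_def dim_span)
  also have "\<dots> \<le> card (DS_columns (N_number f) f C X)"
    by (rule dim_le_card'[OF card_DS_columns(1)])
  also have "\<dots> \<le> N_number f * (CARD('n) + 1)"
    by (rule card_DS_columns(2))
  finally show "CARD('m) \<le> N_number f * (CARD('n) + 1)" .
qed

section \<open>Application to fewer than \<open>N_number f\<close> atoms\<close>

theorem theorem27:
  fixes f :: "'m::finite \<Rightarrow> real^'n::finite \<Rightarrow> real" and r :: nat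
  assumes "\<And>j. C_diff r (f j)"
    and "lin_indep f"
    and "int r > int (N_number f) * (int CARD('n) + 1) - int CARD('m)"
  shows "N_number f \<le> caratheodory_number f \<and>
    {s \<in> moment_sequences f. \<exists>k<N_number f. atomic_representable k f s} \<in> null_sets lebesgue"
proof -
  let ?R = "{s \<in> moment_sequences f. \<exists>k<N_number f. atomic_representable k f s}"
  have meas: "f j \<in> borel_measurable borel" for j
    using Cr_continuous_on[OF C_diff_imp_Cr[OF assms(1)]] by (rule borel_measurable_continuous_onI)
  note N = N_number_works[OF assms(2)]
  have "int (N_number f * (CARD('n) + 1)) < int (r + CARD('m))"
    using assms(3) by (simp add: algebra_simps)
  then have r: "N_number f * (CARD('n) + 1) < r + CARD('m)"
    by (simp only: of_nat_less_iff)
  have "negligible {S_map k f C X |C X. \<forall>i<k. 0 \<le> C i}" if k: "k < N_number f" for k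
  proof (rule negligible_S_map_image[OF assms(1)])
    show "k \<le> CARD('m)" using k N(1) by simp
    show "1 \<le> r" using r N(2) by linarith
    have "k * (CARD('n) + 1) \<le> N_number f * (CARD('n) + 1)"
      using k by (intro mult_right_mono) auto
    then show "k * (CARD('n) + 1) + 1 \<le> r + CARD('m)" using r by linarith
    show "DS_rank k f C X \<noteq> CARD('m)" if "\<And>i. i < k \<Longrightarrow> 0 \<le> C i" for C X
      using not_less_Least[OF k[unfolded N_number_def]] that by blast
  qed
  then have "negligible (\<Union>k\<in>{..<N_number f}. {S_map k f C X |C X. \<forall>i<k. 0 \<le> C i})"
    by (intro negligible_UN_countable) auto
  moreover have "?R \<subseteq> (\<Union>k\<in>{..<N_number f}. {S_map k f C X |C X. \<forall>i<k. 0 \<le> C i})"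
  proof
    fix s assume "s \<in> ?R"
    then obtain k where k: "k < N_number f" "atomic_representable k f s" by blast
    obtain C X where "\<And>i. i < k \<Longrightarrow> 0 \<le> C i" "s = S_map k f C X"
      using atomic_representableD[OF meas k(2)] by blast
    then show "s \<in> (\<Union>k\<in>{..<N_number f}. {S_map k f C X |C X. \<forall>i<k. 0 \<le> C i})"
      using k(1) by blast
  qed
  ultimately have neg: "negligible ?R"
    by (rule negligible_subset)
  have "N_number f \<le> caratheodory_number f"
  proof (rule ccontr)
    assume "\<not> N_number f \<le> caratheodory_number f"
    then have lt: "caratheodory_number f < N_number f" by simp
    have "moment_sequences f \<subseteq> ?R"
    proof
      fix s assume s: "s \<in> moment_sequences f"
      then obtain k where "k \<le> caratheodory_number f" "atomic_representable k f s"
        using caratheodory_number_works[of f, OF meas s] by blast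
      then show "s \<in> ?R"
        using s lt by (intro CollectI conjI exI[of _ k]) auto
    qed
    then show False
      using not_negligible_moment_sequences[of f, OF meas assms(2)] neg negligible_subset by blast
  qed
  then show ?thesis
    using neg by (simp add: negligible_iff_null_sets)
qed

end
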